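(* Let $P \subset (\mathbb{R}^+)^d$ be a convex body such that $\Sigma \subset kP$ for some positive integer $k$. Then there exists a strictly psh $P$-potential; that is, there exists a function $u_P$ on $\mathbb{C}^d$ such that (1) $u_P \in L_P^+(\mathbb{C}^d)$ and $u_P$ is strictly plurisubharmonic on $\mathbb{C}^d$; and (2) there exists a constant $C$ such that $|u_P(z) - H_P(z)| \leq C$ for all $z \in \mathbb{C}^d$.
   Context: Here $\mathbb{R}^+ = [0,\infty)$. A convex body $P \subset (\mathbb{R}^+)^d$ is a compact convex subset of $(\mathbb{R}^+)^d$ with nonempty interior. $\Sigma := \{(x_1,\dots,x_d) \in \mathbb{R}^d : x_1,\dots,x_d \geq 0,\ x_1 + \cdots + x_d \leq 1\}$, and $kP = \{kx : x \in P\}$. The indicator (support) function of $P$ is $\phi_P(x_1,\dots,x_d) := \sup_{(y_1,\dots,y_d)\in P} (x_1 y_1 + \cdots + x_d y_d)$, and the logarithmic indicator function is $H_P(z) := \phi_P(\log|z_1|,\dots,\log|z_d|)$ for $z \in \mathbb{C}^d$; equivalently $H_P(z) = \sup_{J \in P} \log |z^J|$ with $|z^J| := |z_1|^{j_1}\cdots|z_d|^{j_d}$ for $J = (j_1,\dots,j_d)\in P$ (with the convention $0^0 = 1$ when some coordinates vanish). $PSH(\mathbb{C}^d)$ denotes the plurisubharmonic functions on $\mathbb{C}^d$. Define $L_P(\mathbb{C}^d) := \{u \in PSH(\mathbb{C}^d) : u(z) - H_P(z) \leq O(1) \text{ as } |z| \to \infty\}$ (i.e. $u - H_P$ is bounded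 above near infinity), and $L_P^+(\mathbb{C}^d) := \{u \in L_P(\mathbb{C}^d) : \text{there is a constant } c_u \in \mathbb{R} \text{ with } u(z) \geq H_P(z) + c_u \text{ for all } z \in \mathbb{C}^d\}$. A $C^2$ function $u$ on an open set $D \subset \mathbb{C}^d$ is strictly plurisubharmonic (strictly psh) on $D$ if its complex Hessian $\left(\frac{\partial^2 u}{\partial z_j \partial \bar z_k}\right)_{j,k=1}^d$ is positive definite at every point of $D$. *)

theory Defs
  imports "HOL-Analysis.Analysis"
begin

section \<open>Convex bodies and their logarithmic indicator functions\<close>

definition nonneg_orthant :: "(real^'d) set" where
  "nonneg_orthant = {x. \<forall>i. 0 \<le> x $ i}"

definition convex_body :: "(real^'d) set \<Rightarrow> bool" where
  "convex_body P \<longleftrightarrow>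
     P \<subseteq> nonneg_orthant \<and> compact P \<and> convex P \<and> interior P \<noteq> {}"

definition unit_simplex :: "(real^'d) set" where
  "unit_simplex = {x. (\<forall>i. 0 \<le> x $ i) \<and> (\<Sum>i\<in>UNIV. x $ i) \<le> 1}"

text \<open>The indicator function is defined on \<open>[-\<infinity>, \<infinity>]\<^sup>d\<close>, so that it can be evaluated at
  \<open>log |z\<^sub>i| = -\<infinity>\<close>. The rule \<open>0 * (-\<infinity>) = 0\<close> of \<^typ>\<open>ereal\<close> is the logarithmic form of the
  convention \<open>0\<^sup>0 = 1\<close>, whereas \<^term>\<open>(0::real) powr 0\<close> would be \<open>0\<close>.\<close>

definition indicator_fun :: "(real^'d) set \<Rightarrow> ereal^'d \<Rightarrow> ereal" where
  "indicator_fun P x = (SUP y\<in>P. \<Sum>i\<in>UNIV. x $ i * ereal (y $ i))"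

definition log_abs :: "complex \<Rightarrow> ereal" where
  "log_abs w = (if w = 0 then -\<infinity> else ereal (ln (cmod w)))"

definition log_indicator :: "(real^'d) set \<Rightarrow> complex^'d \<Rightarrow> ereal" where
  "log_indicator P z = indicator_fun P (\<chi> i. log_abs (z $ i))"


section \<open>Plurisubharmonic functions\<close>

text \<open>For upper semicontinuous \<open>u < \<infinity>\<close> the first integral is finite, so the mean value over the
  circle \<open>{a + e\<^sup>i\<^sup>\<theta> b}\<close> is well defined in \<open>[-\<infinity>, \<infinity>)\<close>; \<^const>\<open>e2ennreal\<close> sends negative values
  to \<open>0\<close>, so the two integrands are the positive and the negative part.\<close>

definition circle_mean :: "(complex^'d \<Rightarrow> ereal) \<Rightarrow> complex^'d \<Rightarrow> complex^'d \<Rightarrow> ereal" where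
  "circle_mean u a b = ereal (1 / (2 * pi)) *
     (enn2ereal (\<integral>\<^sup>+\<theta>\<in>{0..2*pi}. e2ennreal (u (a + cis \<theta> *s b)) \<partial>lborel)
      - enn2ereal (\<integral>\<^sup>+\<theta>\<in>{0..2*pi}. e2ennreal (- u (a + cis \<theta> *s b)) \<partial>lborel))"

definition PSH :: "(complex^'d \<Rightarrow> ereal) set" where
  "PSH = {u. (\<forall>z. u z < \<infinity>) \<and> (\<exists>z. u z \<noteq> -\<infinity>) \<and>
             (\<forall>c. open {z. u z < c}) \<and>
             (\<forall>a b. u a \<le> circle_mean u a b)}"

text \<open>The bounds on \<open>u - H\<^sub>P\<close> are written additively, since \<open>H\<^sub>P\<close> may take the value \<open>-\<infinity>\<close>
  when \<open>0 \<notin> P\<close>.\<close>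

definition L_class :: "(real^'d) set \<Rightarrow> (complex^'d \<Rightarrow> ereal) set" where
  "L_class P = {u \<in> PSH.
     \<exists>C::real. \<forall>\<^sub>F z in at_infinity. u z \<le> log_indicator P z + ereal C}"

definition L_plus_class :: "(real^'d) set \<Rightarrow> (complex^'d \<Rightarrow> ereal) set" where
  "L_plus_class P = {u \<in> L_class P.
     \<exists>c::real. \<forall>z. log_indicator P z + ereal c \<le> u z}"


section \<open>Strictly plurisubharmonic functions\<close>

definition C1_on :: "'a::euclidean_space set \<Rightarrow> ('a \<Rightarrow> real) \<Rightarrow> bool" where
  "C1_on D f \<longleftrightarrow> (\<forall>x\<in>D. f differentiable (at x)) \<and>
     (\<forall>v. continuous_on D (\<lambda>x. frechet_derivative f (at x) v))"

definition C2_on :: "'a::euclidean_space set \<Rightarrow> ('a \<Rightarrow> real) \<Rightarrow> bool" where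
  "C2_on D f \<longleftrightarrow> C1_on D f \<and> (\<forall>v. C1_on D (\<lambda>x. frechet_derivative f (at x) v))"

text \<open>The Wirtinger operators \<open>\<partial>/\<partial>z\<^sub>j = (\<partial>/\<partial>x\<^sub>j - \<i> \<partial>/\<partial>y\<^sub>j)/2\<close> and
  \<open>\<partial>/\<partial>z\<^sub>j\<^sup>- = (\<partial>/\<partial>x\<^sub>j + \<i> \<partial>/\<partial>y\<^sub>j)/2\<close>, where \<open>z\<^sub>j = x\<^sub>j + \<i> y\<^sub>j\<close>.\<close>

definition wirtinger :: "'d \<Rightarrow> (complex^'d \<Rightarrow> complex) \<Rightarrow> complex^'d \<Rightarrow> complex" where
  "wirtinger j f z =
     (frechet_derivative f (at z) (axis j 1) - \<i> * frechet_derivative f (at z) (axis j \<i>)) / 2"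

definition wirtinger_bar :: "'d \<Rightarrow> (complex^'d \<Rightarrow> complex) \<Rightarrow> complex^'d \<Rightarrow> complex" where
  "wirtinger_bar j f z =
     (frechet_derivative f (at z) (axis j 1) + \<i> * frechet_derivative f (at z) (axis j \<i>)) / 2"

definition complex_hessian :: "(complex^'d \<Rightarrow> real) \<Rightarrow> complex^'d \<Rightarrow> complex^'d^'d" where
  "complex_hessian u z =
     (\<chi> j k. wirtinger j (wirtinger_bar k (\<lambda>w. complex_of_real (u w))) z)"

definition positive_definite :: "complex^'d^'d \<Rightarrow> bool" where
  "positive_definite A \<longleftrightarrow> (\<forall>w. w \<noteq> 0 \<longrightarrow>
     (let q = \<Sum>j\<in>UNIV. \<Sum>k\<in>UNIV. A $ j $ k * w $ j * cnj (w $ k)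
      in q \<in> \<real> \<and> 0 < Re q))"

definition strictly_psh_on :: "(complex^'d) set \<Rightarrow> (complex^'d \<Rightarrow> real) \<Rightarrow> bool" where
  "strictly_psh_on D u \<longleftrightarrow>
     open D \<and> C2_on D u \<and> (\<forall>z\<in>D. positive_definite (complex_hessian u z))"

end

theory Submission
  imports Defs
begin

text \<open>Write \<open>x = (log |z\<^sub>1|, ..., log |z\<^sub>d|)\<close>, so that \<open>H\<^sub>P(z)\<close> is the support function
  \<open>\<phi>\<^sub>P(x)\<close>, a convex function of \<open>x\<close> with gradients in \<open>P\<close>.  Such a function can be
  smoothed by convolution in \<open>x\<close> at a bounded cost, and the result is plurisubharmonic where no
  coordinate of \<open>z\<close> vanishes.  The difficulty is smoothness across the coordinate hyperplanes, since
  \<open>H\<^sub>P\<close> may vary with \<open>z\<^sub>i\<close> (as a non-integral power of \<open>|z\<^sub>i|\<close>, say) arbitrarily close to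
  \<open>z\<^sub>i = 0\<close>.

  The remedy is to reward exponents on the boundary of the orthant: the penalised support function
  is \<open>f\<^sub>0(x) = sup {x \<bullet> y + n(y) | y \<in> P}\<close>, where \<open>n(y)\<close> is the number of vanishing coordinates
  of \<open>y\<close>.  It differs from \<open>\<phi>\<^sub>P\<close> by at most \<open>d\<close>, and by compactness of \<open>P\<close>
  (\<open>reduce_exponent\<close>), as long as the coordinates of \<open>x\<close> are bounded above, an exponent \<open>y\<close> with
  \<open>y\<^sub>i \<noteq> 0\<close> is not needed in the supremum once \<open>x\<^sub>i\<close> is sufficiently negative.
  Hence \<open>f\<^sub>0\<close> is locally independent of \<open>x\<^sub>i\<close> near \<open>x\<^sub>i = -\<infinity>\<close>
  (\<open>penalised_support_local\<close>), its mollification \<open>f\<close> inherits this, and \<open>z \<mapsto> f(x)\<close>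
  extends to a function \<open>v\<close> of class \<open>C\<^sup>2\<close> on the whole of \<open>\<complex>\<^sup>d\<close> with \<open>v - H\<^sub>P\<close> bounded
  (\<open>toric_C2\<close>, \<open>toric_mollified_support\<close>).

  Strictness comes from \<open>V(z) = log (1 + |z|\<^sup>2) / (2 k)\<close>: it is strictly plurisubharmonic, and
  \<open>V \<le> H\<^sub>P + O(1)\<close> because \<open>0\<close> and all \<open>e\<^sub>i / k\<close> lie in \<open>P\<close>.  The potential is
  \<open>u = log (exp v + exp V)\<close>, which is again within \<open>O(1)\<close> of \<open>H\<^sub>P\<close>.  Its Levi form is bounded below
  without computing it: tangents to the convex functions \<open>f\<close> and \<open>(s, t) \<mapsto> log (exp s + exp t)\<close>
  give, at each point, a minorant of \<open>u\<close> which touches \<open>u\<close> there and is the sum of a pluriharmonic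
  function and a positive multiple of \<open>V\<close> (\<open>levi_pos\<close>).  The mean value inequality follows from
  positivity of the Levi form by differentiating circle means with respect to the radius
  (\<open>psh_mean_value\<close>).\<close>

section \<open>Calculus of twice continuously differentiable functions\<close>

lemma C1_onI:
  assumes "\<And>x. x \<in> D \<Longrightarrow> (f has_derivative f' x) (at x)"
    and "\<And>v. continuous_on D (\<lambda>x. f' x v)"
  shows "C1_on D f"
  unfolding C1_on_def
proof (intro conjI ballI allI)
  fix x assume "x \<in> D" then show "f differentiable (at x)"
    using assms(1) differentiable_def by blast
next
  fix v
  have "frechet_derivative f (at x) v = f' x v" if "x \<in> D" for x
    using assms(1)[OF that] frechet_derivative_at by metis
  then show "continuous_on D (\<lambda>x. frechet_derivative f (at x) v)"
    using assms(2)[of v] continuous_on_cong by force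
qed

lemma C1_on_has_derivative:
  assumes "C1_on D f" "x \<in> D"
  shows "(f has_derivative frechet_derivative f (at x)) (at x)"
  using assms unfolding C1_on_def by (simp add: frechet_derivative_works)

lemma C1_on_continuous_derivative:
  "C1_on D f \<Longrightarrow> continuous_on D (\<lambda>x. frechet_derivative f (at x) v)"
  unfolding C1_on_def by blast

lemma C1_on_imp_continuous_on: "C1_on D f \<Longrightarrow> continuous_on D f"
  by (meson C1_on_has_derivative continuous_at_imp_continuous_on has_derivative_continuous)

text \<open>Only agreement with some function of class \<open>C\<^sup>1\<close> near each point is needed; \<open>D\<close> need not be open.\<close>

lemma C1_on_locally:
  assumes "\<And>x. x \<in> D \<Longrightarrow> \<exists>U g. open U \<and> x \<in> U \<and> C1_on U g \<and> (\<forall>y\<in>U. f y = g y)"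
  shows "C1_on D f"
proof -
  have loc: "f differentiable (at x) \<and>
      continuous (at x) (\<lambda>x. frechet_derivative f (at x) v)" if x: "x \<in> D" for x v
  proof -
    obtain U g where U: "open U" "x \<in> U" "C1_on U g" "\<And>y. y \<in> U \<Longrightarrow> f y = g y"
      using assms[OF x] by blast
    have der: "(f has_derivative frechet_derivative g (at y)) (at y)" if "y \<in> U" for y
      using has_derivative_transform_within_open[OF C1_on_has_derivative[OF U(3) that] U(1) that]
        U(4) by simp
    have eq: "frechet_derivative f (at y) = frechet_derivative g (at y)" if "y \<in> U" for y
      using der[OF that] frechet_derivative_at by metis
    have "continuous (at x) (\<lambda>x. frechet_derivative g (at x) v)"
      using C1_on_continuous_derivative[OF U(3)] U(1,2) continuous_on_eq_continuous_at by blast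
    moreover have "\<forall>\<^sub>F y in nhds x. frechet_derivative f (at y) v = frechet_derivative g (at y) v"
      using eq U(1,2) by (auto simp: eventually_nhds)
    ultimately have "isCont (\<lambda>y. frechet_derivative f (at y) v) x"
      by (simp add: isCont_cong)
    then show ?thesis using der[OF U(2)] differentiable_def by blast
  qed
  then show ?thesis unfolding C1_on_def
    by (auto intro: continuous_at_imp_continuous_on)
qed

lemma C1_on_cong:
  assumes "open D" "\<And>x. x \<in> D \<Longrightarrow> f x = g x" "C1_on D g"
  shows "C1_on D f"
  using assms C1_on_locally by metis

lemma C1_on_const: "C1_on D (\<lambda>x. c)"
  by (rule C1_onI[where f' = "\<lambda>x v. 0"]) auto

lemma C1_on_add:
  assumes "C1_on D f" "C1_on D g"
  shows "C1_on D (\<lambda>x. f x + g x)"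
proof (rule C1_onI)
  show "((\<lambda>x. f x + g x) has_derivative (\<lambda>v. frechet_derivative f (at x) v
        + frechet_derivative g (at x) v)) (at x)" if "x \<in> D" for x
    using that by (intro has_derivative_add C1_on_has_derivative[OF assms(1)]
        C1_on_has_derivative[OF assms(2)])
  show "continuous_on D (\<lambda>x. frechet_derivative f (at x) v + frechet_derivative g (at x) v)" for v
    using assms[THEN C1_on_continuous_derivative] by (intro continuous_on_add)
qed

lemma C1_on_mult:
  assumes "C1_on D f" "C1_on D g"
  shows "C1_on D (\<lambda>x. f x * g x)"
proof (rule C1_onI)
  show "((\<lambda>x. f x * g x) has_derivative (\<lambda>v. f x * frechet_derivative g (at x) v
        + frechet_derivative f (at x) v * g x)) (at x)" if "x \<in> D" for x
    using that by (intro has_derivative_mult C1_on_has_derivative[OF assms(1)]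
        C1_on_has_derivative[OF assms(2)])
  show "continuous_on D (\<lambda>x. f x * frechet_derivative g (at x) v
        + frechet_derivative f (at x) v * g x)" for v
    using assms[THEN C1_on_imp_continuous_on] assms[THEN C1_on_continuous_derivative]
    by (intro continuous_on_add continuous_on_mult)
qed

lemma C1_on_sum:
  assumes "\<And>i. i \<in> I \<Longrightarrow> C1_on D (f i)"
  shows "C1_on D (\<lambda>x. \<Sum>i\<in>I. f i x)"
  using assms by (induction I rule: infinite_finite_induct) (auto intro: C1_on_const C1_on_add)

lemma has_derivative_compose_components:
  fixes g :: "'a::euclidean_space \<Rightarrow> 'b::euclidean_space" and f :: "'b \<Rightarrow> real"
  assumes f: "(f has_derivative f') (at (g x))"
    and g: "\<And>b. b \<in> Basis \<Longrightarrow> ((\<lambda>x. g x \<bullet> b) has_derivative g' b) (at x)"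
  shows "((\<lambda>x. f (g x)) has_derivative (\<lambda>v. \<Sum>b\<in>Basis. g' b v * f' b)) (at x)"
proof -
  have "(g has_derivative (\<lambda>v. \<Sum>b\<in>Basis. g' b v *\<^sub>R b)) (at x)"
    by (subst has_derivative_componentwise_within) (auto simp: inner_sum_left_Basis g)
  from has_derivative_compose[OF this f]
  have "((\<lambda>x. f (g x)) has_derivative (\<lambda>v. f' (\<Sum>b\<in>Basis. g' b v *\<^sub>R b))) (at x)" .
  moreover have "linear f'" using f has_derivative_linear by blast
  ultimately show ?thesis by (simp add: linear_sum linear_scale o_def)
qed

lemma continuous_on_components:
  fixes g :: "'a::t2_space \<Rightarrow> 'b::euclidean_space"
  assumes "\<And>b. b \<in> Basis \<Longrightarrow> continuous_on D (\<lambda>x. g x \<bullet> b)"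
  shows "continuous_on D g"
  unfolding continuous_on_componentwise[of D g] using assms by simp

lemma C1_on_compose:
  fixes g :: "'a::euclidean_space \<Rightarrow> 'b::euclidean_space"
  assumes f: "C1_on E f" and g: "\<And>b. b \<in> Basis \<Longrightarrow> C1_on D (\<lambda>x. g x \<bullet> b)"
    and sub: "g ` D \<subseteq> E"
  shows "C1_on D (\<lambda>x. f (g x))"
proof (rule C1_onI)
  fix x assume "x \<in> D"
  then show "((\<lambda>x. f (g x)) has_derivative
      (\<lambda>v. \<Sum>b\<in>Basis. frechet_derivative (\<lambda>x. g x \<bullet> b) (at x) v
        * frechet_derivative f (at (g x)) b)) (at x)"
    using sub by (intro has_derivative_compose_components C1_on_has_derivative[OF f]
      C1_on_has_derivative[OF g]) auto
next
  fix v
  have "continuous_on D g"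
    by (rule continuous_on_components) (intro C1_on_imp_continuous_on g)
  then have "continuous_on D (\<lambda>x. frechet_derivative f (at (g x)) b)" for b
    by (rule continuous_on_compose2[OF C1_on_continuous_derivative[OF f] _ sub])
  then show "continuous_on D (\<lambda>x. \<Sum>b\<in>Basis. frechet_derivative (\<lambda>x. g x \<bullet> b) (at x) v
        * frechet_derivative f (at (g x)) b)"
    using C1_on_continuous_derivative[OF g] by (intro continuous_on_sum continuous_on_mult) auto
qed

lemma C2_onI:
  assumes "open D" "\<And>x. x \<in> D \<Longrightarrow> (f has_derivative f' x) (at x)"
    and "\<And>v. C1_on D (\<lambda>x. f' x v)"
  shows "C2_on D f"
  unfolding C2_on_def
proof (intro conjI allI)
  show "C1_on D f"
    by (rule C1_onI[OF assms(2)]) (auto intro: C1_on_imp_continuous_on assms)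
  fix v
  have "frechet_derivative f (at x) v = f' x v" if "x \<in> D" for x
    using assms(2)[OF that] frechet_derivative_at by metis
  then show "C1_on D (\<lambda>x. frechet_derivative f (at x) v)"
    using C1_on_cong[OF assms(1) _ assms(3)] by simp
qed

lemma C2_on_imp_C1_on: "C2_on D f \<Longrightarrow> C1_on D f"
  and C2_on_imp_C1_on_derivative: "C2_on D f \<Longrightarrow> C1_on D (\<lambda>x. frechet_derivative f (at x) v)"
  unfolding C2_on_def by blast+

lemma C2_on_has_derivative:
  "C2_on D f \<Longrightarrow> x \<in> D \<Longrightarrow> (f has_derivative frechet_derivative f (at x)) (at x)"
  using C1_on_has_derivative C2_on_imp_C1_on by blast

lemma C2_on_locally:
  assumes "\<And>x. x \<in> D \<Longrightarrow> \<exists>U g. open U \<and> x \<in> U \<and> C2_on U g \<and> (\<forall>y\<in>U. f y = g y)"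
  shows "C2_on D f"
  unfolding C2_on_def
proof (intro conjI allI C1_on_locally)
  fix x assume x: "x \<in> D"
  obtain U g where U: "open U" "x \<in> U" "C2_on U g" "\<And>y. y \<in> U \<Longrightarrow> f y = g y"
    using assms[OF x] by blast
  then show "\<exists>U g. open U \<and> x \<in> U \<and> C1_on U g \<and> (\<forall>y\<in>U. f y = g y)"
    using C2_on_imp_C1_on by blast
  fix v
  have "(f has_derivative frechet_derivative g (at y)) (at y)" if "y \<in> U" for y
    using has_derivative_transform_within_open[OF C2_on_has_derivative[OF U(3) that] U(1) that]
      U(4) by simp
  then have "frechet_derivative f (at y) v = frechet_derivative g (at y) v" if "y \<in> U" for y
    using that frechet_derivative_at by metis
  then show "\<exists>U h. open U \<and> x \<in> U \<and> C1_on U h \<and>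
      (\<forall>y\<in>U. frechet_derivative f (at y) v = h y)"
    using U(1,2) C2_on_imp_C1_on_derivative[OF U(3)] by blast
qed

lemma C2_on_const: "open D \<Longrightarrow> C2_on D (\<lambda>x. c)"
  by (rule C2_onI[where f' = "\<lambda>x v. 0"]) (auto intro: C1_on_const)

lemma C2_on_linear:
  assumes "open D" "bounded_linear f"
  shows "C2_on D f"
  by (rule C2_onI[where f' = "\<lambda>x. f"])
    (auto intro: C1_on_const assms bounded_linear_imp_has_derivative)

lemma C2_on_add:
  assumes "open D" "C2_on D f" "C2_on D g"
  shows "C2_on D (\<lambda>x. f x + g x)"
proof (rule C2_onI[OF assms(1)])
  show "((\<lambda>x. f x + g x) has_derivative (\<lambda>v. frechet_derivative f (at x) v
        + frechet_derivative g (at x) v)) (at x)" if "x \<in> D" for x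
    using that by (intro has_derivative_add C2_on_has_derivative[OF assms(2)]
        C2_on_has_derivative[OF assms(3)])
  show "C1_on D (\<lambda>x. frechet_derivative f (at x) v + frechet_derivative g (at x) v)" for v
    using assms(2,3)[THEN C2_on_imp_C1_on_derivative] by (intro C1_on_add)
qed

lemma C2_on_mult:
  assumes "open D" "C2_on D f" "C2_on D g"
  shows "C2_on D (\<lambda>x. f x * g x)"
proof (rule C2_onI[OF assms(1)])
  show "((\<lambda>x. f x * g x) has_derivative (\<lambda>v. f x * frechet_derivative g (at x) v
        + frechet_derivative f (at x) v * g x)) (at x)" if "x \<in> D" for x
    using that by (intro has_derivative_mult C2_on_has_derivative[OF assms(2)]
        C2_on_has_derivative[OF assms(3)])
  show "C1_on D (\<lambda>x. f x * frechet_derivative g (at x) v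
        + frechet_derivative f (at x) v * g x)" for v
    using assms(2,3)[THEN C2_on_imp_C1_on] assms(2,3)[THEN C2_on_imp_C1_on_derivative]
    by (intro C1_on_add C1_on_mult)
qed

lemma C2_on_sum:
  assumes "open D" "\<And>i. i \<in> I \<Longrightarrow> C2_on D (f i)"
  shows "C2_on D (\<lambda>x. \<Sum>i\<in>I. f i x)"
  using assms(2) by (induction I rule: infinite_finite_induct)
    (auto intro: C2_on_const C2_on_add assms(1))

lemma C2_on_compose:
  fixes g :: "'a::euclidean_space \<Rightarrow> 'b::euclidean_space"
  assumes "open D" and f: "C2_on E f" and g: "\<And>b. b \<in> Basis \<Longrightarrow> C2_on D (\<lambda>x. g x \<bullet> b)"
    and sub: "g ` D \<subseteq> E"
  shows "C2_on D (\<lambda>x. f (g x))"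
proof (rule C2_onI[OF \<open>open D\<close>])
  fix x assume "x \<in> D"
  then show "((\<lambda>x. f (g x)) has_derivative
      (\<lambda>v. \<Sum>b\<in>Basis. frechet_derivative (\<lambda>x. g x \<bullet> b) (at x) v
        * frechet_derivative f (at (g x)) b)) (at x)"
    using sub by (intro has_derivative_compose_components C2_on_has_derivative[OF f]
      C2_on_has_derivative[OF g]) auto
next
  fix v
  show "C1_on D (\<lambda>x. \<Sum>b\<in>Basis. frechet_derivative (\<lambda>x. g x \<bullet> b) (at x) v
        * frechet_derivative f (at (g x)) b)"
  proof (rule C1_on_sum, rule C1_on_mult)
    fix b :: 'b assume b: "b \<in> Basis"
    show "C1_on D (\<lambda>x. frechet_derivative (\<lambda>x. g x \<bullet> b) (at x) v)"
      using C2_on_imp_C1_on_derivative[OF g[OF b]] .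
    show "C1_on D (\<lambda>x. frechet_derivative f (at (g x)) b)"
      by (rule C1_on_compose[OF C2_on_imp_C1_on_derivative[OF f] _ sub])
        (rule C2_on_imp_C1_on[OF g])
  qed
qed

lemma C2_on_compose_real:
  fixes g :: "'a::euclidean_space \<Rightarrow> real"
  assumes "open D" and f: "C2_on E f" and g: "C2_on D g" and sub: "g ` D \<subseteq> E"
  shows "C2_on D (\<lambda>x. f (g x))"
  using C2_on_compose[OF assms(1) f _ sub] g by simp

lemma C2_on_real:
  fixes f :: "real \<Rightarrow> real"
  assumes "open D" "\<And>x. x \<in> D \<Longrightarrow> (f has_real_derivative f' x) (at x)"
    "\<And>x. x \<in> D \<Longrightarrow> (f' has_real_derivative f'' x) (at x)" "continuous_on D f''"
  shows "C2_on D f"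
proof (rule C2_onI[OF assms(1)])
  show "(f has_derivative (*) (f' x)) (at x)" if "x \<in> D" for x
    using assms(2)[OF that] by (simp add: has_field_derivative_def)
  show "C1_on D (\<lambda>x. f' x * v)" for v
  proof (rule C1_onI)
    show "((\<lambda>x. f' x * v) has_derivative (\<lambda>w. f'' x * w * v)) (at x)" if "x \<in> D" for x
      using has_derivative_mult_left[OF assms(3)[OF that, unfolded has_field_derivative_def]] .
    show "continuous_on D (\<lambda>x. f'' x * w * v)" for w
      by (intro continuous_intros assms(4))
  qed
qed

lemma C2_on_exp: "C2_on UNIV (exp :: real \<Rightarrow> real)"
  by (rule C2_on_real[OF open_UNIV DERIV_exp DERIV_exp continuous_on_exp[OF continuous_on_id]])

lemma C2_on_ln: "C2_on {0<..} (ln :: real \<Rightarrow> real)"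
proof (rule C2_on_real)
  show "(ln has_real_derivative inverse x) (at x)" if "x \<in> {0<..}" for x :: real
    using that DERIV_ln by simp
  show "(inverse has_real_derivative - (inverse x ^ Suc (Suc 0))) (at x)"
    if "x \<in> {0<..}" for x :: real
    using DERIV_inverse[of x UNIV] that by simp
  show "continuous_on {0<..} (\<lambda>x::real. - (inverse x ^ Suc (Suc 0)))"
    by (intro continuous_intros) auto
qed simp

section \<open>Second derivatives and the Levi form\<close>

text \<open>The second derivative of \<open>u\<close> at \<open>z\<close>, first in direction \<open>a\<close>, then in direction \<open>b\<close>.\<close>

definition second_derivative :: "('a::euclidean_space \<Rightarrow> real) \<Rightarrow> 'a \<Rightarrow> 'a \<Rightarrow> 'a \<Rightarrow> real" where
  "second_derivative u z a b = frechet_derivative (\<lambda>x. frechet_derivative u (at x) a) (at z) b"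

lemma has_real_derivative_along:
  fixes u :: "'a::euclidean_space \<Rightarrow> real"
  assumes u: "(u has_derivative u') (at (p t))" and p: "(p has_vector_derivative q) (at t)"
  shows "((\<lambda>t. u (p t)) has_real_derivative u' q) (at t)"
proof -
  have "((\<lambda>t. u (p t)) has_derivative (\<lambda>h. u' (h *\<^sub>R q))) (at t)"
    using has_derivative_compose[OF p[unfolded has_vector_derivative_def] u] .
  moreover have "(\<lambda>h. u' (h *\<^sub>R q)) = (\<lambda>h. u' q * h)"
    using has_derivative_linear[OF u] by (auto simp: linear_scale)
  ultimately show ?thesis by (simp add: has_field_derivative_def)
qed

lemma C2_has_real_derivative_along:
  fixes u :: "'a::euclidean_space \<Rightarrow> real"
  assumes "C2_on UNIV u" and p: "(p has_vector_derivative q) (at t)"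
  shows "((\<lambda>t. u (p t)) has_real_derivative frechet_derivative u (at (p t)) q) (at t)"
    and "((\<lambda>t. frechet_derivative u (at (p t)) v) has_real_derivative
        second_derivative u (p t) v q) (at t)"
proof -
  show "((\<lambda>t. u (p t)) has_real_derivative frechet_derivative u (at (p t)) q) (at t)"
    by (rule has_real_derivative_along[OF C2_on_has_derivative[OF assms(1) UNIV_I] p])
  show "((\<lambda>t. frechet_derivative u (at (p t)) v) has_real_derivative
        second_derivative u (p t) v q) (at t)"
    unfolding second_derivative_def
    by (rule has_real_derivative_along[OF
          C1_on_has_derivative[OF C2_on_imp_C1_on_derivative[OF assms(1)] UNIV_I] p])
qed

lemma has_vector_derivative_line:
  "((\<lambda>t::real. z + t *\<^sub>R w) has_vector_derivative w) (at t)"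
  by (auto intro!: derivative_eq_intros)

lemma continuous_on_second_derivative:
  "C2_on UNIV u \<Longrightarrow> continuous_on UNIV (\<lambda>z. second_derivative u z a b)"
  unfolding second_derivative_def
  by (intro C1_on_continuous_derivative C2_on_imp_C1_on_derivative)

lemma linear_second_derivative_right:
  assumes "C2_on UNIV u"
  shows "linear (second_derivative u z a)"
proof -
  have "((\<lambda>x. frechet_derivative u (at x) a) has_derivative second_derivative u z a) (at z)"
    unfolding second_derivative_def
    using C1_on_has_derivative[OF C2_on_imp_C1_on_derivative[OF assms]] by blast
  then show ?thesis using has_derivative_linear by blast
qed

text \<open>The mean value theorem applied twice; exchanging \<open>a\<close> and \<open>b\<close> leaves the left-hand side
  unchanged, whence the symmetry of the second derivative.\<close>

lemma second_difference:
  fixes u :: "'a::euclidean_space \<Rightarrow> real"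
  assumes u: "C2_on UNIV u" and h: "0 < h"
  obtains s t where "0 < s" "s < h" "0 < t" "t < h"
    "u (z + h *\<^sub>R a + h *\<^sub>R b) - u (z + h *\<^sub>R a) - u (z + h *\<^sub>R b) + u z
      = h * h * second_derivative u (z + s *\<^sub>R a + t *\<^sub>R b) a b"
proof -
  define g where "g s = u (z + s *\<^sub>R a + h *\<^sub>R b) - u (z + s *\<^sub>R a)" for s
  have g': "(g has_real_derivative frechet_derivative u (at (z + s *\<^sub>R a + h *\<^sub>R b)) a
      - frechet_derivative u (at (z + s *\<^sub>R a)) a) (at s)" for s
    unfolding g_def
    by (intro DERIV_diff C2_has_real_derivative_along(1)[OF u] has_vector_derivative_line)
      (auto intro!: derivative_eq_intros)
  obtain s where s: "0 < s" "s < h" "g h - g 0 = (h - 0) *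
      (frechet_derivative u (at (z + s *\<^sub>R a + h *\<^sub>R b)) a
      - frechet_derivative u (at (z + s *\<^sub>R a)) a)"
    using MVT2[OF h g'] by blast
  define k where "k t = frechet_derivative u (at (z + s *\<^sub>R a + t *\<^sub>R b)) a" for t
  have k': "(k has_real_derivative second_derivative u (z + s *\<^sub>R a + t *\<^sub>R b) a b) (at t)" for t
    unfolding k_def by (intro C2_has_real_derivative_along(2)[OF u] has_vector_derivative_line)
  obtain t where t: "0 < t" "t < h" "k h - k 0 = (h - 0) *
      second_derivative u (z + s *\<^sub>R a + t *\<^sub>R b) a b"
    using MVT2[OF h k'] by blast
  have "g h - g 0 = h * (k h - k 0)" using s(3) by (simp add: k_def)
  also have "\<dots> = h * h * second_derivative u (z + s *\<^sub>R a + t *\<^sub>R b) a b" using t(3) by simp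
  finally show ?thesis using that[OF s(1,2) t(1,2)] by (simp add: g_def algebra_simps)
qed

lemma second_derivative_tendsto:
  fixes u :: "'a::euclidean_space \<Rightarrow> real" and h :: "nat \<Rightarrow> real"
  assumes u: "C2_on UNIV u" and h: "h \<longlonglongrightarrow> 0" "\<And>n. 0 < h n"
  shows "(\<lambda>n. (u (z + h n *\<^sub>R a + h n *\<^sub>R b) - u (z + h n *\<^sub>R a) - u (z + h n *\<^sub>R b) + u z)
      / (h n * h n)) \<longlonglongrightarrow> second_derivative u z a b"
proof -
  have "\<forall>n. \<exists>s t. 0 < s \<and> s < h n \<and> 0 < t \<and> t < h n \<and>
      u (z + h n *\<^sub>R a + h n *\<^sub>R b) - u (z + h n *\<^sub>R a) - u (z + h n *\<^sub>R b) + u z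
      = h n * h n * second_derivative u (z + s *\<^sub>R a + t *\<^sub>R b) a b"
    by (meson second_difference[OF u h(2)])
  then obtain s t where st: "\<And>n. 0 < s n" "\<And>n. s n < h n" "\<And>n. 0 < t n" "\<And>n. t n < h n"
    "\<And>n. u (z + h n *\<^sub>R a + h n *\<^sub>R b) - u (z + h n *\<^sub>R a) - u (z + h n *\<^sub>R b) + u z
      = h n * h n * second_derivative u (z + s n *\<^sub>R a + t n *\<^sub>R b) a b"
    by metis
  have "s \<longlonglongrightarrow> 0"
    by (rule tendsto_sandwich[OF _ _ tendsto_const h(1)]) (auto intro!: always_eventually less_imp_le st)
  moreover have "t \<longlonglongrightarrow> 0"
    by (rule tendsto_sandwich[OF _ _ tendsto_const h(1)]) (auto intro!: always_eventually less_imp_le st)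
  ultimately have "(\<lambda>n. z + s n *\<^sub>R a + t n *\<^sub>R b) \<longlonglongrightarrow> z + 0 *\<^sub>R a + 0 *\<^sub>R b"
    by (intro tendsto_intros)
  then have p: "(\<lambda>n. z + s n *\<^sub>R a + t n *\<^sub>R b) \<longlonglongrightarrow> z" by simp
  have "isCont (\<lambda>z. second_derivative u z a b) z"
    using continuous_on_second_derivative[OF u] continuous_on_eq_continuous_at by blast
  from isCont_tendsto_compose[OF this p] show ?thesis
    using st(5) h(2) by (simp add: less_imp_neq[symmetric])
qed

lemma second_derivative_symmetric:
  fixes u :: "'a::euclidean_space \<Rightarrow> real"
  assumes u: "C2_on UNIV u"
  shows "second_derivative u z a b = second_derivative u z b a"
proof -
  define h where "h n = inverse (real (Suc n))" for n
  have h: "h \<longlonglongrightarrow> 0" "\<And>n. 0 < h n"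
    unfolding h_def by (rule LIMSEQ_inverse_real_of_nat) simp
  from second_derivative_tendsto[OF u h, of z b a]
  have "(\<lambda>n. (u (z + h n *\<^sub>R a + h n *\<^sub>R b) - u (z + h n *\<^sub>R a) - u (z + h n *\<^sub>R b) + u z)
      / (h n * h n)) \<longlonglongrightarrow> second_derivative u z b a"
    by (simp add: algebra_simps)
  with second_derivative_tendsto[OF u h, of z a b] show ?thesis
    using LIMSEQ_unique by blast
qed

lemma linear_second_derivative_left:
  "C2_on UNIV u \<Longrightarrow> linear (\<lambda>a. second_derivative u z a b)"
  using linear_second_derivative_right[of u z b] second_derivative_symmetric[of u z _ b] by simp

text \<open>The Levi form, normalised to be the Laplacian of \<open>\<lambda> \<mapsto> u (z + \<lambda> w)\<close> at \<open>0\<close>, which is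
  four times the quadratic form of the complex Hessian.\<close>

definition levi :: "(complex^'d \<Rightarrow> real) \<Rightarrow> complex^'d \<Rightarrow> complex^'d \<Rightarrow> real" where
  "levi u z w = second_derivative u z w w + second_derivative u z (\<i> *s w) (\<i> *s w)"

lemma levi_zero: "C2_on UNIV u \<Longrightarrow> levi u z 0 = 0"
  using linear_0[OF linear_second_derivative_right] by (simp add: levi_def)

lemma vector_smult_complex:
  fixes w :: "complex^'d"
  shows "c *s w = Re c *\<^sub>R w + Im c *\<^sub>R (\<i> *s w)"
  by (simp add: vec_eq_iff complex_eq_iff)

lemma i_smult_simps:
  fixes w :: "complex^'d"
  shows "\<i> *s (\<i> *s w) = - w" "\<i> *s (a + b) = \<i> *s a + (\<i> *s b :: complex^'d)"
    "\<i> *s (r *\<^sub>R w) = r *\<^sub>R (\<i> *s w)"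
  by (simp_all add: vec_eq_iff algebra_simps)

text \<open>The sesquilinear form with matrix the complex Hessian, linear in \<open>a\<close> and antilinear in \<open>b\<close>.\<close>

definition hessian_form :: "(complex^'d \<Rightarrow> real) \<Rightarrow> complex^'d \<Rightarrow> complex^'d \<Rightarrow> complex^'d \<Rightarrow> complex"
  where "hessian_form u z a b =
    Complex ((second_derivative u z b a + second_derivative u z (\<i> *s b) (\<i> *s a)) / 4)
      ((second_derivative u z (\<i> *s b) a - second_derivative u z b (\<i> *s a)) / 4)"

lemma complex_hessian_nth:
  fixes u :: "complex^'d \<Rightarrow> real"
  assumes u: "C2_on UNIV u"
  shows "complex_hessian u z $ j $ k = hessian_form u z (axis j 1) (axis k 1)"
proof -
  let ?D = "\<lambda>x. frechet_derivative u (at x)"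
  have D: "frechet_derivative (\<lambda>w. complex_of_real (u w)) (at x) = (\<lambda>v. of_real (?D x v))" for x
    using frechet_derivative_at[OF has_derivative_of_real[OF C2_on_has_derivative[OF u UNIV_I]]] by metis
  have bar: "wirtinger_bar k (\<lambda>w. complex_of_real (u w))
      = (\<lambda>x. (of_real (?D x (axis k 1)) + \<i> * of_real (?D x (axis k \<i>))) / 2)"
    unfolding wirtinger_bar_def D ..
  have D': "((\<lambda>x. ?D x v) has_derivative second_derivative u z v) (at z)" for v
    unfolding second_derivative_def
    using C1_on_has_derivative[OF C2_on_imp_C1_on_derivative[OF u]] by blast
  have "((\<lambda>x. (of_real (?D x (axis k 1)) + \<i> * of_real (?D x (axis k \<i>))) / 2) has_derivative
      (\<lambda>v. (of_real (second_derivative u z (axis k 1) v)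
        + \<i> * of_real (second_derivative u z (axis k \<i>) v)) / 2)) (at z)"
    by (intro bounded_linear.has_derivative[OF bounded_linear_divide] has_derivative_add has_derivative_mult_right
        has_derivative_of_real D')
  from frechet_derivative_at[OF this] bar
  have D2: "frechet_derivative (wirtinger_bar k (\<lambda>w. complex_of_real (u w))) (at z) =
      (\<lambda>v. (of_real (second_derivative u z (axis k 1) v)
        + \<i> * of_real (second_derivative u z (axis k \<i>) v)) / 2)" by simp
  have ax: "axis j \<i> = \<i> *s (axis j 1 :: complex^'d)" for j
    by (simp add: vec_eq_iff axis_def)
  show ?thesis
    unfolding complex_hessian_def wirtinger_def
    by (simp add: D2 hessian_form_def ax complex_eq_iff field_simps)
qed

lemma
  assumes u: "C2_on UNIV u"
  shows hessian_form_add_left: "hessian_form u z (a + a') b = hessian_form u z a b + hessian_form u z a' b"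
    and hessian_form_add_right: "hessian_form u z a (b + b') = hessian_form u z a b + hessian_form u z a b'"
    and hessian_form_smult_left: "hessian_form u z (c *s a) b = c * hessian_form u z a b"
    and hessian_form_smult_right: "hessian_form u z a (c *s b) = cnj c * hessian_form u z a b"
proof -
  note l = linear_second_derivative_right[OF u] linear_second_derivative_left[OF u]
  note simps = l[THEN linear_add] l[THEN linear_diff] l[THEN linear_scale] l[THEN linear_neg] i_smult_simps
  show "hessian_form u z (a + a') b = hessian_form u z a b + hessian_form u z a' b"
    "hessian_form u z a (b + b') = hessian_form u z a b + hessian_form u z a b'"
    by (simp_all add: hessian_form_def simps complex_eq_iff field_simps)
  show "hessian_form u z (c *s a) b = c * hessian_form u z a b"
    "hessian_form u z a (c *s b) = cnj c * hessian_form u z a b"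
    unfolding vector_smult_complex[of c]
    by (simp_all add: hessian_form_def simps complex_eq_iff field_simps)
qed

lemma hessian_form_sum:
  fixes u :: "complex^'d \<Rightarrow> real"
  assumes u: "C2_on UNIV u"
  shows "hessian_form u z w w' =
    (\<Sum>j\<in>UNIV. \<Sum>k\<in>UNIV. hessian_form u z (axis j 1) (axis k 1) * w $ j * cnj (w' $ k))"
proof -
  have 0: "hessian_form u z 0 b = 0" "hessian_form u z b 0 = 0" for b
    using hessian_form_smult_left[OF u, of z 0 0 b] hessian_form_smult_right[OF u, of z b 0 0]
    by auto
  have 1: "hessian_form u z (\<Sum>j\<in>I. f j) b = (\<Sum>j\<in>I. hessian_form u z (f j) b)"
    for b and f :: "'d \<Rightarrow> complex^'d" and I
    by (induction I rule: infinite_finite_induct) (auto simp: 0 hessian_form_add_left[OF u])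
  have 2: "hessian_form u z b (\<Sum>j\<in>I. f j) = (\<Sum>j\<in>I. hessian_form u z b (f j))"
    for b and f :: "'d \<Rightarrow> complex^'d" and I
    by (induction I rule: infinite_finite_induct) (auto simp: 0 hessian_form_add_right[OF u])
  have "hessian_form u z w w' = hessian_form u z (\<Sum>j\<in>UNIV. w $ j *s axis j 1)
      (\<Sum>k\<in>UNIV. w' $ k *s axis k 1)"
    by (simp add: basis_expansion)
  also have "\<dots> = (\<Sum>j\<in>UNIV. \<Sum>k\<in>UNIV. hessian_form u z (axis j 1) (axis k 1) * w $ j * cnj (w' $ k))"
    unfolding 1 unfolding 2 unfolding hessian_form_smult_left[OF u] hessian_form_smult_right[OF u]
    by (simp add: mult_ac)
  finally show ?thesis .
qed

lemma complex_hessian_quadratic_form: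
  fixes u :: "complex^'d \<Rightarrow> real"
  assumes u: "C2_on UNIV u"
  shows "(\<Sum>j\<in>UNIV. \<Sum>k\<in>UNIV. complex_hessian u z $ j $ k * w $ j * cnj (w $ k))
    = of_real (levi u z w / 4)"
proof -
  have "(\<Sum>j\<in>UNIV. \<Sum>k\<in>UNIV. complex_hessian u z $ j $ k * w $ j * cnj (w $ k)) = hessian_form u z w w"
    by (simp add: complex_hessian_nth[OF u] hessian_form_sum[OF u, of z w w])
  also have "\<dots> = of_real (levi u z w / 4)"
    using second_derivative_symmetric[OF u, of z "\<i> *s w" w]
    by (simp add: hessian_form_def levi_def complex_eq_iff)
  finally show ?thesis .
qed

lemma strictly_psh_on_UNIV_I:
  assumes u: "C2_on UNIV u" and "\<And>z w. w \<noteq> 0 \<Longrightarrow> 0 < levi u z w"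
  shows "strictly_psh_on UNIV u"
  unfolding strictly_psh_on_def positive_definite_def Let_def complex_hessian_quadratic_form[OF u]
  using assms by simp

section \<open>The mean value inequality\<close>

lemma circle_has_vector_derivative:
  fixes a b :: "complex^'d"
  shows "((\<lambda>\<theta>. a + r *\<^sub>R (cis \<theta> *s b)) has_vector_derivative r *\<^sub>R (\<i> *s (cis \<theta> *s b))) (at \<theta>)"
proof -
  have "((\<lambda>\<theta>. a + r *\<^sub>R (cos \<theta> *\<^sub>R b + sin \<theta> *\<^sub>R (\<i> *s b))) has_vector_derivative
      r *\<^sub>R ((- sin \<theta>) *\<^sub>R b + cos \<theta> *\<^sub>R (\<i> *s b))) (at \<theta>)"
    by (auto intro!: derivative_eq_intros)
  moreover have "cos \<theta> *\<^sub>R b + sin \<theta> *\<^sub>R (\<i> *s b) = cis \<theta> *s b" for \<theta>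
    using vector_smult_complex[of "cis \<theta>" b] by simp
  moreover have "(- sin \<theta>) *\<^sub>R b + cos \<theta> *\<^sub>R (\<i> *s b) = \<i> *s (cis \<theta> *s b)"
    by (simp add: vec_eq_iff complex_eq_iff)
  ultimately show ?thesis by simp
qed

text \<open>If \<open>M(r)\<close> is the integral of \<open>u\<close> over the circle of radius \<open>r\<close>, then \<open>(r M'(r))'\<close> is
  \<open>r\<close> times the integral of the Levi form; so \<open>M\<close> increases from \<open>M(0) = 2 \<pi> u(a)\<close>.\<close>

lemma psh_mean_value:
  fixes u :: "complex^'d \<Rightarrow> real"
  assumes u: "C2_on UNIV u" and levi: "\<And>z w. 0 \<le> levi u z w"
  shows "2 * pi * u a \<le> integral {0..2*pi} (\<lambda>\<theta>. u (a + cis \<theta> *s b))"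
proof -
  define e where "e \<theta> = cis \<theta> *s b" for \<theta>
  define p where "p r \<theta> = a + r *\<^sub>R e \<theta>" for r \<theta>
  define D where "D z v = frechet_derivative u (at z) v" for z v
  define D2 where "D2 = second_derivative u"
  have e: "e \<theta> = cos \<theta> *\<^sub>R b + sin \<theta> *\<^sub>R (\<i> *s b)"
    "\<i> *s e \<theta> = (- sin \<theta>) *\<^sub>R b + cos \<theta> *\<^sub>R (\<i> *s b)" for \<theta>
    unfolding e_def by (simp_all add: vec_eq_iff complex_eq_iff)
  have linD: "linear (D z)" for z
    unfolding D_def using C2_on_has_derivative[OF u UNIV_I] has_derivative_linear by blast
  note linD2 = linear_second_derivative_right[OF u, folded D2_def]
    linear_second_derivative_left[OF u, folded D2_def]
  have D_e: "D z (e \<theta>) = cos \<theta> * D z b + sin \<theta> * D z (\<i> *s b)"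
    "D z (\<i> *s e \<theta>) = cos \<theta> * D z (\<i> *s b) - sin \<theta> * D z b" for z \<theta>
    unfolding e(2) unfolding e(1) by (simp_all only: linear_add[OF linD] linear_scale[OF linD]) simp_all
  have D2_e: "D2 z (e \<theta>) v = cos \<theta> * D2 z b v + sin \<theta> * D2 z (\<i> *s b) v"
    "D2 z (\<i> *s e \<theta>) v = cos \<theta> * D2 z (\<i> *s b) v - sin \<theta> * D2 z b v" for z v \<theta>
    unfolding e(2) unfolding e(1) by (simp_all only: linear_add[OF linD2(2)] linear_scale[OF linD2(2)]) simp_all
  have D2_e': "D2 z v (e \<theta>) = cos \<theta> * D2 z v b + sin \<theta> * D2 z v (\<i> *s b)"
    "D2 z v (\<i> *s e \<theta>) = cos \<theta> * D2 z v (\<i> *s b) - sin \<theta> * D2 z v b" for z v \<theta>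
    unfolding e(2) unfolding e(1) by (simp_all only: linear_add[OF linD2(1)] linear_scale[OF linD2(1)]) simp_all
  have p_cont: "continuous_on S (\<lambda>(r, \<theta>). p r \<theta>)" for S
    unfolding p_def e by (auto simp: split_beta intro!: continuous_intros)
  have cont: "continuous_on S (\<lambda>x. h (p (fst x) (snd x)))"
    if "continuous_on UNIV h" for h :: "_ \<Rightarrow> real" and S
    using continuous_on_compose2[OF that p_cont[of S]] by (simp add: split_beta)
  have cont1: "continuous_on S (\<lambda>\<theta>. h (p r \<theta>))"
    if h: "continuous_on UNIV h" for h :: "_ \<Rightarrow> real" and S r
  proof -
    have "continuous_on S (\<lambda>\<theta>. p r \<theta>)" unfolding p_def e by (intro continuous_intros)
    then show ?thesis using continuous_on_compose2[OF h] by blast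
  qed
  have cu: "continuous_on UNIV u"
    using u C1_on_imp_continuous_on C2_on_imp_C1_on by blast
  have cD: "continuous_on UNIV (\<lambda>z. D z v)" for v
    unfolding D_def using C1_on_continuous_derivative[OF C2_on_imp_C1_on[OF u]] .
  have cD2: "continuous_on UNIV (\<lambda>z. D2 z v w)" for v w
    unfolding D2_def using continuous_on_second_derivative[OF u] .
  have p_r: "((\<lambda>r. p r \<theta>) has_vector_derivative e \<theta>) (at r)" for r \<theta>
    unfolding p_def by (rule has_vector_derivative_line)
  have p_th: "((\<lambda>\<theta>. p r \<theta>) has_vector_derivative r *\<^sub>R (\<i> *s e \<theta>)) (at \<theta>)" for r \<theta>
    unfolding p_def e_def by (rule circle_has_vector_derivative)
  note along = C2_has_real_derivative_along[OF u, folded D_def D2_def]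

  \<comment> \<open>the mean over the circle of radius \<open>r\<close>, its derivative, and the second derivative\<close>
  define M where "M r = integral {0..2*pi} (\<lambda>\<theta>. u (p r \<theta>))" for r
  define N where "N r = integral {0..2*pi} (\<lambda>\<theta>. D (p r \<theta>) (e \<theta>))" for r
  define R where "R r = integral {0..2*pi} (\<lambda>\<theta>. D2 (p r \<theta>) (e \<theta>) (e \<theta>))" for r
  have M': "(M has_real_derivative N r) (at r)" for r
    unfolding M_def N_def interval_cbox
  proof (rule leibniz_rule_field_derivative[where U = UNIV])
    show "((\<lambda>r. u (p r \<theta>)) has_real_derivative D (p r \<theta>) (e \<theta>)) (at r)" for r \<theta>
      by (rule along(1)[OF p_r])
    show "(\<lambda>\<theta>. u (p r \<theta>)) integrable_on cbox 0 (2 * pi)" for r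
      by (intro integrable_continuous cont1 cu)
    show "continuous_on (UNIV \<times> cbox 0 (2 * pi)) (\<lambda>(r, \<theta>). D (p r \<theta>) (e \<theta>))"
      unfolding split_beta D_e by (intro continuous_intros cont cD)
  qed auto
  have N': "(N has_real_derivative R r) (at r)" for r
    unfolding N_def R_def interval_cbox
  proof (rule leibniz_rule_field_derivative[where U = UNIV])
    show "((\<lambda>r. D (p r \<theta>) (e \<theta>)) has_real_derivative D2 (p r \<theta>) (e \<theta>) (e \<theta>)) (at r)" for r \<theta>
      by (rule along(2)[OF p_r])
    show "(\<lambda>\<theta>. D (p r \<theta>) (e \<theta>)) integrable_on cbox 0 (2 * pi)" for r
      unfolding D_e by (intro integrable_continuous continuous_intros cont1 cD)
    show "continuous_on (UNIV \<times> cbox 0 (2 * pi)) (\<lambda>(r, \<theta>). D2 (p r \<theta>) (e \<theta>) (e \<theta>))"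
      unfolding split_beta D2_e D2_e' by (intro continuous_intros cont cD2)
  qed auto
  \<comment> \<open>the derivative of the angular derivative integrates to \<open>0\<close> over the circle\<close>
  have N_eq: "N r = r * integral {0..2*pi} (\<lambda>\<theta>. D2 (p r \<theta>) (\<i> *s e \<theta>) (\<i> *s e \<theta>))" for r
  proof -
    have "((\<lambda>\<theta>. D (p r \<theta>) (\<i> *s e \<theta>)) has_real_derivative
        r * D2 (p r \<theta>) (\<i> *s e \<theta>) (\<i> *s e \<theta>) - D (p r \<theta>) (e \<theta>)) (at \<theta>)" for \<theta>
    proof -
      have "((\<lambda>\<theta>. cos \<theta> * D (p r \<theta>) (\<i> *s b) - sin \<theta> * D (p r \<theta>) b) has_real_derivative
          (- sin \<theta> * D (p r \<theta>) (\<i> *s b) + D2 (p r \<theta>) (\<i> *s b) (r *\<^sub>R (\<i> *s e \<theta>)) * cos \<theta>)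
          - (cos \<theta> * D (p r \<theta>) b + D2 (p r \<theta>) b (r *\<^sub>R (\<i> *s e \<theta>)) * sin \<theta>)) (at \<theta>)"
        by (rule DERIV_diff[OF DERIV_mult[OF DERIV_cos along(2)[OF p_th]]
              DERIV_mult[OF DERIV_sin along(2)[OF p_th]]])
      also have "(- sin \<theta> * D (p r \<theta>) (\<i> *s b) + D2 (p r \<theta>) (\<i> *s b) (r *\<^sub>R (\<i> *s e \<theta>)) * cos \<theta>)
          - (cos \<theta> * D (p r \<theta>) b + D2 (p r \<theta>) b (r *\<^sub>R (\<i> *s e \<theta>)) * sin \<theta>)
          = r * D2 (p r \<theta>) (\<i> *s e \<theta>) (\<i> *s e \<theta>) - D (p r \<theta>) (e \<theta>)"
        unfolding D_e D2_e linear_scale[OF linD2(1)] by (simp add: algebra_simps)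
      finally show ?thesis unfolding D_e(2) .
    qed
    then have "((\<lambda>\<theta>. r * D2 (p r \<theta>) (\<i> *s e \<theta>) (\<i> *s e \<theta>) - D (p r \<theta>) (e \<theta>)) has_integral
        D (p r (2 * pi)) (\<i> *s e (2 * pi)) - D (p r 0) (\<i> *s e 0)) {0..2*pi}"
      by (intro fundamental_theorem_of_calculus)
        (auto simp: has_real_derivative_iff_has_vector_derivative intro: has_vector_derivative_at_within)
    then have "integral {0..2*pi} (\<lambda>\<theta>. r * D2 (p r \<theta>) (\<i> *s e \<theta>) (\<i> *s e \<theta>) - D (p r \<theta>) (e \<theta>)) = 0"
      by (simp add: integral_unique p_def e_def)
    moreover have "(\<lambda>\<theta>. r * D2 (p r \<theta>) (\<i> *s e \<theta>) (\<i> *s e \<theta>)) integrable_on {0..2*pi}"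
      "(\<lambda>\<theta>. D (p r \<theta>) (e \<theta>)) integrable_on {0..2*pi}"
      unfolding D_e D2_e D2_e'
      by (intro integrable_continuous_interval continuous_intros cont1 cD cD2)+
    ultimately show ?thesis by (simp add: N_def Henstock_Kurzweil_Integration.integral_diff)
  qed
  have Q': "((\<lambda>r. r * N r) has_real_derivative
      r * integral {0..2*pi} (\<lambda>\<theta>. levi u (p r \<theta>) (e \<theta>))) (at r)" for r
  proof -
    have "integral {0..2*pi} (\<lambda>\<theta>. levi u (p r \<theta>) (e \<theta>)) = R r +
        integral {0..2*pi} (\<lambda>\<theta>. D2 (p r \<theta>) (\<i> *s e \<theta>) (\<i> *s e \<theta>))"
      unfolding levi_def R_def D2_def[symmetric] D2_e D2_e'
      by (intro Henstock_Kurzweil_Integration.integral_add integrable_continuous_interval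
          continuous_intros cont1 cD2)
    then have "r * integral {0..2*pi} (\<lambda>\<theta>. levi u (p r \<theta>) (e \<theta>)) = 1 * N r + R r * r"
      using N_eq[of r] by (simp add: algebra_simps)
    then show ?thesis using DERIV_mult[OF DERIV_ident N'] by metis
  qed
  have "0 \<le> r * N r" if "0 \<le> r" for r
  proof -
    have "\<exists>y. ((\<lambda>r. r * N r) has_real_derivative y) (at s) \<and> 0 \<le> y" if "0 \<le> s" for s
    proof -
      have "0 \<le> integral {0..2*pi} (\<lambda>\<theta>. levi u (p s \<theta>) (e \<theta>))"
      proof (rule integral_nonneg)
        show "(\<lambda>\<theta>. levi u (p s \<theta>) (e \<theta>)) integrable_on {0..2*pi}"
          unfolding levi_def D2_def[symmetric] D2_e D2_e'
          by (intro integrable_continuous_interval continuous_intros cont1 cD2)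
      qed (rule levi)
      then show ?thesis using Q'[of s] that mult_nonneg_nonneg by blast
    qed
    then have "0 * N 0 \<le> r * N r"
      by (intro DERIV_nonneg_imp_nondecreasing[OF that]) auto
    then show ?thesis by simp
  qed
  from this[OF less_imp_le] have N0: "0 \<le> N r" if "0 < r" for r
    using that mult_le_cancel_left_pos[OF that, of 0 "N r"] by simp
  have "M 0 \<le> M 1"
  proof (rule DERIV_nonneg_imp_increasing_open[of 0 1 M])
    show "\<exists>y. (M has_real_derivative y) (at x) \<and> 0 \<le> y" if "0 < x" for x
      using M' N0[OF that] by blast
    show "continuous_on {0..1} M"
      using M' DERIV_continuous continuous_at_imp_continuous_on by blast
  qed simp
  then show ?thesis by (simp add: M_def p_def e_def)
qed

lemma circle_mean_continuous:
  fixes u :: "complex^'d \<Rightarrow> real"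
  assumes u: "continuous_on UNIV u"
  shows "circle_mean (\<lambda>z. ereal (u z)) a b =
    ereal (1 / (2 * pi) * integral {0..2*pi} (\<lambda>\<theta>. u (a + cis \<theta> *s b)))"
proof -
  define g where "g \<theta> = u (a + cis \<theta> *s b)" for \<theta>
  have "continuous_on {0..2*pi} (\<lambda>\<theta>. a + cis \<theta> *s b)"
    by (subst vector_smult_complex) (intro continuous_intros)
  then have g: "continuous_on {0..2*pi} g"
    unfolding g_def using continuous_on_compose2[OF u] by blast
  define G where "G \<theta> = indicator {0..2*pi} \<theta> *\<^sub>R g \<theta>" for \<theta>
  have int: "integrable lborel G"
    using borel_integrable_atLeastAtMost'[OF g] by (simp add: set_integrable_def G_def[abs_def])
  have nn: "(\<integral>\<^sup>+\<theta>. ennreal (G \<theta>) \<partial>lborel) < \<infinity>" "(\<integral>\<^sup>+\<theta>. ennreal (- G \<theta>) \<partial>lborel) < \<infinity>"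
    using int by (auto simp: real_integrable_def less_top)
  have fin: "enn2ereal X = ereal (enn2real X)" if "X < \<infinity>" for X
    using that enn2ereal_ennreal[of "enn2real X"] by simp
  have eq: "(\<integral>\<^sup>+\<theta>\<in>{0..2*pi}. e2ennreal (ereal (s * g \<theta>)) \<partial>lborel) = (\<integral>\<^sup>+\<theta>. ennreal (s * G \<theta>) \<partial>lborel)" for s
    by (intro nn_integral_cong) (auto simp: G_def indicator_def e2ennreal_ereal)
  have "circle_mean (\<lambda>z. ereal (u z)) a b = ereal (1 / (2 * pi)) *
      (enn2ereal (\<integral>\<^sup>+\<theta>. ennreal (G \<theta>) \<partial>lborel) - enn2ereal (\<integral>\<^sup>+\<theta>. ennreal (- G \<theta>) \<partial>lborel))"
    using eq[of 1] eq[of "-1"] by (simp add: circle_mean_def g_def)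
  also have "\<dots> = ereal (1 / (2 * pi)) * ereal (integral\<^sup>L lborel G)"
    unfolding real_lebesgue_integral_def[OF int]
    using fin[OF nn(1)] fin[OF nn(2)] by simp
  also have "integral\<^sup>L lborel G = integral {0..2*pi} g"
    using set_borel_integral_eq_integral(2)[of "{0..2*pi}" g] int
    by (simp add: set_integrable_def set_lebesgue_integral_def G_def[abs_def])
  finally show ?thesis by (simp add: g_def[abs_def])
qed

lemma psh_in_PSH:
  fixes u :: "complex^'d \<Rightarrow> real"
  assumes u: "C2_on UNIV u" and levi: "\<And>z w. 0 \<le> levi u z w"
  shows "(\<lambda>z. ereal (u z)) \<in> PSH"
proof -
  have cu: "continuous_on UNIV u"
    using u C1_on_imp_continuous_on C2_on_imp_C1_on by blast
  have "open {z. ereal (u z) < c}" for c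
    using cu by (intro open_Collect_less continuous_intros) auto
  moreover have "ereal (u a) \<le> circle_mean (\<lambda>z. ereal (u z)) a b" for a b
    using psh_mean_value[OF assms, of a b] by (simp add: circle_mean_continuous[OF cu] field_simps)
  ultimately show ?thesis by (simp add: PSH_def)
qed

section \<open>Mollification\<close>

lemma pos_part_power_has_derivative:
  "((\<lambda>x::real. max 0 x ^ Suc (Suc n)) has_real_derivative real (Suc (Suc n)) * max 0 x ^ Suc n) (at x)"
proof (cases x "0::real" rule: linorder_cases)
  case less
  have "((\<lambda>x::real. 0) has_real_derivative real (Suc (Suc n)) * max 0 x ^ Suc n) (at x)"
    using less by (auto intro!: derivative_eq_intros)
  then show ?thesis
    by (rule has_field_derivative_transform_within_open[of _ _ _ "{..<0}"]) (use less in auto)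
next
  case greater
  have "((\<lambda>x::real. x ^ Suc (Suc n)) has_real_derivative real (Suc (Suc n)) * max 0 x ^ Suc n) (at x)"
    using greater DERIV_pow[of "Suc (Suc n)" x] by simp
  then show ?thesis
    by (rule has_field_derivative_transform_within_open[of _ _ _ "{0<..}"]) (use greater in auto)
next
  case equal
  have "((\<lambda>h::real. max 0 h ^ Suc (Suc n) / h) \<longlongrightarrow> 0) (at 0)"
  proof (rule Lim_null_comparison)
    have "norm (max 0 h ^ Suc (Suc n) / h) \<le> max 0 h ^ Suc n" for h :: real
      by (cases "h \<le> 0") (auto simp: max_def)
    then show "\<forall>\<^sub>F h::real in at 0. norm (max 0 h ^ Suc (Suc n) / h) \<le> max 0 h ^ Suc n"
      by simp
    have "isCont (\<lambda>h::real. max 0 h ^ Suc n) 0" by (intro continuous_intros)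
    then show "((\<lambda>h::real. max 0 h ^ Suc n) \<longlongrightarrow> 0) (at 0)" by (simp add: isCont_def)
  qed
  then show ?thesis using equal by (simp add: DERIV_def)
qed

text \<open>A box containing the closed unit ball, the domain of integration of the convolutions below.\<close>

definition unit_box :: "'a::euclidean_space set" where
  "unit_box = cbox (- One) One"

lemma cball_subset_unit_box: "cball 0 1 \<subseteq> (unit_box :: 'a::euclidean_space set)"
proof
  fix t :: 'a assume "t \<in> cball 0 1"
  then have "\<bar>t \<bullet> b\<bar> \<le> 1" if "b \<in> Basis" for b
    using Basis_le_norm[OF that, of t] by simp
  then show "t \<in> unit_box" by (auto simp: unit_box_def mem_box abs_le_iff minus_le_iff)
qed

text \<open>For a kernel \<open>\<phi>\<close> that vanishes outside the unit ball, this is the convolution of \<open>f\<close> with \<open>\<phi>\<close>.\<close>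

definition convolution :: "('a::euclidean_space \<Rightarrow> real) \<Rightarrow> ('a \<Rightarrow> real) \<Rightarrow> 'a \<Rightarrow> real" where
  "convolution \<phi> f x = integral unit_box (\<lambda>t. f (x - t) * \<phi> t)"

lemma convolution_integrable:
  fixes f :: "'a::euclidean_space \<Rightarrow> real"
  assumes "continuous_on UNIV f" "continuous_on UNIV \<phi>"
  shows "(\<lambda>t. f (x - t) * \<phi> t) integrable_on unit_box"
proof -
  have "continuous_on unit_box (\<lambda>t. f (x - t))"
    by (rule continuous_on_compose2[OF assms(1)]) (auto intro!: continuous_intros)
  then show ?thesis unfolding unit_box_def
    by (intro integrable_continuous continuous_intros continuous_on_subset[OF assms(2)]) auto
qed

text \<open>Substituting \<open>t \<mapsto> x - t\<close> moves the dependence on \<open>x\<close> to the kernel, with a domain of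
  integration that is the same for all \<open>x\<close> in a ball.\<close>

lemma convolution_eq_kernel:
  fixes f :: "'a::euclidean_space \<Rightarrow> real"
  assumes f: "continuous_on UNIV f" and \<phi>: "continuous_on UNIV \<phi>"
    and supp: "\<And>t. t \<notin> cball 0 1 \<Longrightarrow> \<phi> t = 0" and x: "norm x \<le> R"
  shows "convolution \<phi> f x
    = integral (cbox (- ((R + 1) *\<^sub>R One)) ((R + 1) *\<^sub>R One)) (\<lambda>t. f t * \<phi> (x - t))"
proof -
  let ?S = "(\<lambda>s. (1 / - 1) *\<^sub>R s + - ((1 / - 1) *\<^sub>R x)) ` cbox (- One) (One :: 'a)"
  have "((\<lambda>t. f (x - t) * \<phi> t) has_integral convolution \<phi> f x) (cbox (- One) One)"
    using convolution_integrable[OF f \<phi>, of x]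
    by (simp add: convolution_def unit_box_def integrable_integral)
  from has_integral_affinity[OF this, of "- 1" x]
  have *: "((\<lambda>t. f t * \<phi> (x - t)) has_integral convolution \<phi> f x) ?S"
    by simp
  have "?S \<subseteq> cbox (- ((R + 1) *\<^sub>R One)) ((R + 1) *\<^sub>R One)"
  proof
    fix s assume "s \<in> ?S"
    then obtain t where t: "t \<in> cbox (- One) (One :: 'a)" "s = x - t" by auto
    have "- (R + 1) \<le> s \<bullet> b \<and> s \<bullet> b \<le> R + 1" if b: "b \<in> Basis" for b
      using Basis_le_norm[OF b, of x] x t b by (force simp: mem_box inner_diff_left abs_le_iff)
    then show "s \<in> cbox (- ((R + 1) *\<^sub>R One)) ((R + 1) *\<^sub>R One)" by (auto simp: mem_box)
  qed
  moreover have "f t * \<phi> (x - t) = 0" if "t \<notin> ?S" for t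
  proof -
    have "x - t \<notin> unit_box"
    proof
      assume "x - t \<in> unit_box"
      then show False using that by (auto simp: unit_box_def image_iff dest!: bspec[of _ _ "x - t"])
    qed
    then show ?thesis using cball_subset_unit_box supp by fastforce
  qed
  ultimately show ?thesis
    using integral_unique[OF has_integral_on_superset[OF *]] by simp
qed

lemma convolution_continuous:
  fixes f :: "'a::euclidean_space \<Rightarrow> real"
  assumes f: "continuous_on UNIV f" and \<phi>: "continuous_on UNIV \<phi>"
  shows "continuous_on UNIV (convolution \<phi> f)"
  unfolding convolution_def[abs_def] unit_box_def
proof (rule integral_continuous_on_param)
  show "continuous_on (UNIV \<times> cbox (- One) One) (\<lambda>(x, t). f (x - t) * \<phi> t)"
    unfolding split_beta
    by (intro continuous_on_mult continuous_on_compose2[OF f] continuous_on_compose2[OF \<phi>]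
        continuous_intros) auto
qed

lemma convolution_has_derivative:
  fixes f :: "'a::euclidean_space \<Rightarrow> real" and \<phi>' :: "'a \<Rightarrow> 'a \<Rightarrow>\<^sub>L real"
  assumes f: "continuous_on UNIV f" and \<phi>: "\<And>t. (\<phi> has_derivative \<phi>' t) (at t)"
    and \<phi>': "continuous_on UNIV \<phi>'"
    and supp: "\<And>t. t \<notin> cball 0 1 \<Longrightarrow> \<phi> t = 0" "\<And>t. t \<notin> cball 0 1 \<Longrightarrow> \<phi>' t = 0"
  shows "(convolution \<phi> f has_derivative (\<lambda>v. convolution (\<lambda>t. \<phi>' t v) f x)) (at x)"
proof -
  define R where "R = norm x + 1"
  let ?K = "cbox (- ((R + 1) *\<^sub>R One)) ((R + 1) *\<^sub>R One) :: 'a set"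
  have c\<phi>: "continuous_on UNIV \<phi>"
    using \<phi> has_derivative_continuous continuous_at_imp_continuous_on by blast
  have fx: "continuous_on (UNIV \<times> ?K) (\<lambda>(x, t). f t *\<^sub>R \<phi>' (x - t))"
    unfolding split_beta
    by (intro continuous_on_scaleR continuous_on_compose2[OF f] continuous_on_compose2[OF \<phi>']
        continuous_intros) auto
  have fxx: "continuous_on ?K (\<lambda>t. f t *\<^sub>R \<phi>' (x - t))"
    by (intro continuous_on_scaleR continuous_on_compose2[OF f] continuous_on_compose2[OF \<phi>']
        continuous_intros) auto
  have "((\<lambda>x. integral ?K (\<lambda>t. f t * \<phi> (x - t))) has_derivative
      blinfun_apply (integral ?K (\<lambda>t. f t *\<^sub>R \<phi>' (x - t)))) (at x within UNIV)"
  proof (rule leibniz_rule[OF _ _ fx])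
    show "((\<lambda>x. f t * \<phi> (x - t)) has_derivative blinfun_apply (f t *\<^sub>R \<phi>' (x - t))) (at x)" for x t
    proof -
      have "((\<lambda>x. x - t) has_derivative (\<lambda>v. v)) (at x)"
        by (auto intro!: derivative_eq_intros)
      from has_derivative_mult_right[OF has_derivative_compose[OF this \<phi>], of "f t"]
      show ?thesis by (simp add: scaleR_blinfun.rep_eq)
    qed
    show "(\<lambda>t. f t * \<phi> (x - t)) integrable_on ?K" for x
      by (intro integrable_continuous continuous_on_mult continuous_on_compose2[OF f]
          continuous_on_compose2[OF c\<phi>] continuous_intros) auto
  qed auto
  moreover have "blinfun_apply (integral ?K (\<lambda>t. f t *\<^sub>R \<phi>' (x - t))) v
      = convolution (\<lambda>t. \<phi>' t v) f x" for v
  proof -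
    have "blinfun_apply (integral ?K (\<lambda>t. f t *\<^sub>R \<phi>' (x - t))) v
        = integral ?K (\<lambda>t. blinfun_apply (f t *\<^sub>R \<phi>' (x - t)) v)"
      using integral_linear[OF integrable_continuous[OF fxx] bounded_linear_apply_blinfun, of v]
      by (simp add: o_def)
    also have "\<dots> = convolution (\<lambda>t. \<phi>' t v) f x"
    proof (subst convolution_eq_kernel[OF f, where R = R])
      show "continuous_on UNIV (\<lambda>t. \<phi>' t v)"
        using \<phi>' by (intro continuous_intros)
    qed (auto simp: supp R_def scaleR_blinfun.rep_eq)
    finally show ?thesis .
  qed
  then have "blinfun_apply (integral ?K (\<lambda>t. f t *\<^sub>R \<phi>' (x - t)))
      = (\<lambda>v. convolution (\<lambda>t. \<phi>' t v) f x)" by (rule ext)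
  ultimately have "((\<lambda>x. integral ?K (\<lambda>t. f t * \<phi> (x - t))) has_derivative
      (\<lambda>v. convolution (\<lambda>t. \<phi>' t v) f x)) (at x)"
    by simp
  then show ?thesis
  proof (rule has_derivative_transform_within_open)
    show "open (ball x 1)" "x \<in> ball x 1" by auto
    show "integral ?K (\<lambda>t. f t * \<phi> (y - t)) = convolution \<phi> f y" if "y \<in> ball x 1" for y
    proof (rule convolution_eq_kernel[OF f c\<phi> supp(1), symmetric])
      show "norm y \<le> R" using that norm_triangle_sub[of y x]
        by (simp add: R_def dist_norm norm_minus_commute)
    qed
  qed
qed

text \<open>The kernel \<open>(1 - |x|\<^sup>2)\<^sub>+\<^sup>3\<close>, supported in the unit ball; the exponent \<open>3\<close> makes it of
  class \<open>C\<^sup>2\<close>. It is not normalised.\<close>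

definition bump :: "'a::euclidean_space \<Rightarrow> real" where
  "bump x = max 0 (1 - x \<bullet> x) ^ 3"

text \<open>The first derivative of the kernel, and the derivative of its component in direction \<open>v\<close>.\<close>

definition bump' :: "'a::euclidean_space \<Rightarrow> 'a \<Rightarrow>\<^sub>L real" where
  "bump' x = (- 6 * max 0 (1 - x \<bullet> x) ^ 2) *\<^sub>R blinfun_inner_left x"

definition bump'' :: "'a::euclidean_space \<Rightarrow> 'a \<Rightarrow> 'a \<Rightarrow>\<^sub>L real" where
  "bump'' v x = (24 * max 0 (1 - x \<bullet> x) * (v \<bullet> x)) *\<^sub>R blinfun_inner_left x
     + (- 6 * max 0 (1 - x \<bullet> x) ^ 2) *\<^sub>R blinfun_inner_left v"

lemma bump_eq_0:
  assumes "x \<notin> cball 0 1"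
  shows "bump x = 0" "bump' x = 0" "bump'' v x = 0"
proof -
  have "1 < norm x ^ 2" using assms by (simp add: one_less_power)
  then have "max 0 (1 - x \<bullet> x) = 0" by (simp add: power2_norm_eq_inner)
  then show "bump x = 0" "bump' x = 0" "bump'' v x = 0"
    by (simp_all add: bump_def bump'_def bump''_def)
qed

lemma one_minus_norm_derivative:
  "((\<lambda>x::'a::real_inner. 1 - x \<bullet> x) has_derivative (\<lambda>v. - 2 * (x \<bullet> v))) (at x)"
  by (auto intro!: derivative_eq_intros simp: inner_commute)

lemma bump_has_derivative:
  fixes x :: "'a::euclidean_space"
  shows "(bump has_derivative bump' x) (at x)"
proof -
  have "((\<lambda>x::'a. max 0 (1 - x \<bullet> x) ^ Suc (Suc 1)) has_derivative
      (\<lambda>v. real (Suc (Suc 1)) * max 0 (1 - x \<bullet> x) ^ Suc 1 * (- 2 * (x \<bullet> v)))) (at x)"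
    using has_derivative_compose[OF one_minus_norm_derivative
        pos_part_power_has_derivative[unfolded has_field_derivative_def]] .
  moreover have "(\<lambda>x::'a. max 0 (1 - x \<bullet> x) ^ Suc (Suc 1)) = bump"
    by (simp add: bump_def[abs_def] eval_nat_numeral)
  moreover have "(\<lambda>v. real (Suc (Suc 1)) * max 0 (1 - x \<bullet> x) ^ Suc 1 * (- 2 * (x \<bullet> v))) = bump' x"
    by (auto simp: bump'_def scaleR_blinfun.rep_eq uminus_blinfun.rep_eq eval_nat_numeral
        inner_commute mult_ac)
  ultimately show ?thesis by (simp only:)
qed

lemma bump'_has_derivative: "((\<lambda>x. bump' x v) has_derivative bump'' v x) (at x)"
proof -
  have 1: "((\<lambda>x. max 0 (1 - x \<bullet> x) ^ Suc (Suc 0)) has_derivative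
      (\<lambda>w. real (Suc (Suc 0)) * max 0 (1 - x \<bullet> x) ^ Suc 0 * (- 2 * (x \<bullet> w)))) (at x)"
    using has_derivative_compose[OF one_minus_norm_derivative
        pos_part_power_has_derivative[unfolded has_field_derivative_def]] .
  have "((\<lambda>x. - 6 * (max 0 (1 - x \<bullet> x) ^ Suc (Suc 0) * (v \<bullet> x))) has_derivative
      (\<lambda>w. - 6 * (max 0 (1 - x \<bullet> x) ^ Suc (Suc 0) * (v \<bullet> w)
        + real (Suc (Suc 0)) * max 0 (1 - x \<bullet> x) ^ Suc 0 * (- 2 * (x \<bullet> w)) * (v \<bullet> x)))) (at x)"
    by (intro has_derivative_mult_right has_derivative_mult[OF 1] has_derivative_inner_right
        has_derivative_ident)
  moreover have "(\<lambda>x. bump' x v) = (\<lambda>x. - 6 * (max 0 (1 - x \<bullet> x) ^ Suc (Suc 0) * (v \<bullet> x)))"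
    by (auto simp: bump'_def scaleR_blinfun.rep_eq uminus_blinfun.rep_eq eval_nat_numeral
        inner_commute)
  moreover have "blinfun_apply (bump'' v x) = (\<lambda>w. - 6 * (max 0 (1 - x \<bullet> x) ^ Suc (Suc 0) * (v \<bullet> w)
        + real (Suc (Suc 0)) * max 0 (1 - x \<bullet> x) ^ Suc 0 * (- 2 * (x \<bullet> w)) * (v \<bullet> x)))"
    by (auto simp: bump''_def scaleR_blinfun.rep_eq plus_blinfun.rep_eq
        uminus_blinfun.rep_eq minus_blinfun.rep_eq
        eval_nat_numeral inner_commute algebra_simps fun_eq_iff)
  ultimately show ?thesis by simp
qed

lemma continuous_bump: "continuous_on S bump" "continuous_on S bump'" "continuous_on S (bump'' v)"
  unfolding bump_def[abs_def] bump'_def[abs_def] bump''_def[abs_def]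
  by (intro continuous_intros)+

lemma bump_nonneg: "0 \<le> bump x" by (simp add: bump_def)

text \<open>The integral of the kernel, as a function of the type of the underlying space.\<close>

definition bump_mass :: "'a::euclidean_space itself \<Rightarrow> real" where
  "bump_mass _ = integral unit_box (bump :: 'a \<Rightarrow> real)"

lemma bump_mass_pos: "0 < bump_mass TYPE('a::euclidean_space)"
proof -
  have int: "(bump :: 'a \<Rightarrow> real) integrable_on unit_box"
    unfolding unit_box_def by (intro integrable_continuous continuous_bump)
  have "0 \<le> bump_mass TYPE('a)"
    unfolding bump_mass_def by (intro integral_nonneg int bump_nonneg)
  moreover have "bump_mass TYPE('a) \<noteq> 0"
  proof
    assume "bump_mass TYPE('a) = 0"
    then have "((bump :: 'a \<Rightarrow> real) has_integral 0) (cbox (- One) One)"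
      using integrable_integral[OF int] by (simp add: bump_mass_def unit_box_def)
    moreover have "(0::'a) \<in> cbox (- One) One" "box (- One) (One :: 'a) \<noteq> {}"
      by (auto simp: mem_box box_ne_empty)
    ultimately have "bump (0::'a) = 0"
      using has_integral_0_cbox_imp_0[of "- One" One "bump :: 'a \<Rightarrow> real" 0]
      by (simp add: continuous_bump bump_nonneg)
    then show False by (simp add: bump_def)
  qed
  ultimately show ?thesis by simp
qed

text \<open>The average of \<open>f\<close> over the unit ball about \<open>x\<close>, weighted by the normalised kernel.\<close>

definition mollify :: "('a::euclidean_space \<Rightarrow> real) \<Rightarrow> 'a \<Rightarrow> real" where
  "mollify f x = convolution bump f x / bump_mass TYPE('a)"

lemma mollify_C2:
  fixes f :: "'a::euclidean_space \<Rightarrow> real"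
  assumes f: "continuous_on UNIV f"
  shows "C2_on UNIV (mollify f)"
proof -
  have "C2_on UNIV (convolution bump f)"
  proof (rule C2_onI)
    show "(convolution bump f has_derivative (\<lambda>v. convolution (\<lambda>t. bump' t v) f x)) (at x)" for x
      by (rule convolution_has_derivative[OF f bump_has_derivative continuous_bump(2) bump_eq_0(1,2)])
    show "C1_on UNIV (\<lambda>x. convolution (\<lambda>t. bump' t v) f x)" for v
    proof (rule C1_onI)
      show "(convolution (\<lambda>t. bump' t v) f has_derivative
          (\<lambda>w. convolution (\<lambda>t. bump'' v t w) f x)) (at x)" for x
        by (rule convolution_has_derivative[OF f bump'_has_derivative continuous_bump(3) _ bump_eq_0(3)])
          (simp add: bump_eq_0)
      show "continuous_on UNIV (\<lambda>x. convolution (\<lambda>t. bump'' v t w) f x)" for w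
        by (intro convolution_continuous[OF f] continuous_intros continuous_bump)
    qed
  qed simp
  from C2_on_mult[OF open_UNIV C2_on_const[OF open_UNIV, of "inverse (bump_mass TYPE('a))"] this]
  show ?thesis by (simp add: mollify_def[abs_def] field_simps)
qed

lemma mollify_mono:
  fixes f g :: "'a::euclidean_space \<Rightarrow> real"
  assumes f: "continuous_on UNIV f" and g: "continuous_on UNIV g"
    and le: "\<And>t. norm t \<le> 1 \<Longrightarrow> f (x - t) \<le> g (y - t)"
  shows "mollify f x \<le> mollify g y"
proof -
  have "convolution bump f x \<le> convolution bump g y"
    unfolding convolution_def
  proof (intro integral_le convolution_integrable f g continuous_bump)
    show "f (x - t) * bump t \<le> g (y - t) * bump t" for t
    proof (cases "t \<in> cball 0 1")
      case True then show ?thesis using le[of t] by (intro mult_right_mono bump_nonneg) simp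
    qed (simp add: bump_eq_0)
  qed
  then show ?thesis using bump_mass_pos[where 'a = 'a] by (simp add: mollify_def divide_right_mono)
qed

lemma mollify_const: "mollify (\<lambda>x::'a::euclidean_space. c) x = c"
  using bump_mass_pos[where 'a = 'a]
  by (simp add: mollify_def convolution_def bump_mass_def)

lemma mollify_near:
  fixes f :: "'a::euclidean_space \<Rightarrow> real"
  assumes lip: "\<And>x y. \<bar>f x - f y\<bar> \<le> L * norm (x - y)" and L: "0 \<le> L"
  shows "\<bar>mollify f x - f x\<bar> \<le> L"
proof -
  have f: "continuous_on UNIV f"
    by (rule lipschitz_on_continuous_on[of L]) (auto simp: lipschitz_on_def dist_norm L lip)
  have *: "\<bar>f (x - t) - f x\<bar> \<le> L" if "norm t \<le> 1" for t
    using lip[of "x - t" x] mult_left_mono[OF that L] by simp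
  have "mollify f x \<le> mollify (\<lambda>_::'a. f x + L) x"
    using * by (intro mollify_mono f) (auto simp: abs_le_iff algebra_simps)
  moreover have "mollify (\<lambda>_::'a. f x - L) x \<le> mollify f x"
    using * by (intro mollify_mono f) (auto simp: abs_le_iff algebra_simps)
  ultimately show ?thesis by (simp add: mollify_const abs_le_iff)
qed

lemma mollify_convex:
  fixes f :: "'a::euclidean_space \<Rightarrow> real"
  assumes f: "continuous_on UNIV f" and conv: "convex_on UNIV f"
  shows "convex_on UNIV (mollify f)"
proof (rule convex_onI)
  fix s :: real and x y :: 'a assume s: "0 < s" "s < 1"
  have "convolution bump f ((1 - s) *\<^sub>R x + s *\<^sub>R y)
    \<le> integral unit_box (\<lambda>t. (1 - s) * (f (x - t) * bump t) + s * (f (y - t) * bump t))"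
    unfolding convolution_def
  proof (intro integral_le integrable_add integrable_on_mult_right
      convolution_integrable f continuous_bump)
    fix t
    have "((1 - s) *\<^sub>R x + s *\<^sub>R y) - t = (1 - s) *\<^sub>R (x - t) + s *\<^sub>R (y - t)"
      by (simp add: algebra_simps)
    then have "f (((1 - s) *\<^sub>R x + s *\<^sub>R y) - t) \<le> (1 - s) * f (x - t) + s * f (y - t)"
      using convex_onD[OF conv, of s "x - t" "y - t"] s by simp
    from mult_right_mono[OF this bump_nonneg]
    show "f ((1 - s) *\<^sub>R x + s *\<^sub>R y - t) * bump t
        \<le> (1 - s) * (f (x - t) * bump t) + s * (f (y - t) * bump t)"
      by (simp add: algebra_simps)
  qed
  also have "\<dots> = (1 - s) * convolution bump f x + s * convolution bump f y"
    unfolding convolution_def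
    by (subst Henstock_Kurzweil_Integration.integral_add)
      (auto intro!: integrable_on_mult_right convolution_integrable f continuous_bump)
  finally have "convolution bump f ((1 - s) *\<^sub>R x + s *\<^sub>R y)
    \<le> (1 - s) * convolution bump f x + s * convolution bump f y" .
  then show "mollify f ((1 - s) *\<^sub>R x + s *\<^sub>R y) \<le> (1 - s) * mollify f x + s * mollify f y"
    using bump_mass_pos[where 'a = 'a] by (simp add: mollify_def field_simps)
qed simp

section \<open>The penalised support function\<close>

text \<open>The number of vanishing coordinates of an exponent \<open>y\<close>.\<close>

definition zero_count :: "real^'d \<Rightarrow> nat" where
  "zero_count y = card {i. y $ i = 0}"

text \<open>The support function of \<open>P\<close> with a bonus of \<open>1\<close> for each vanishing coordinate of the exponent.
  The bonus is discontinuous in \<open>y\<close>, which is what makes coordinate faces win near \<open>x\<^sub>i = -\<infinity>\<close>.\<close>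

definition penalised_support :: "(real^'d) set \<Rightarrow> real^'d \<Rightarrow> real" where
  "penalised_support P x = (SUP y\<in>P. x \<bullet> y + real (zero_count y))"

lemma zero_count_le: "zero_count (y :: real^'d) \<le> CARD('d)"
  unfolding zero_count_def by (rule card_mono) auto

lemma eventually_zero_set_subset:
  fixes Y :: "nat \<Rightarrow> real^'d"
  assumes "Y \<longlonglongrightarrow> y"
  shows "\<forall>\<^sub>F n in sequentially. {i. Y n $ i = 0} \<subseteq> {i. y $ i = 0}"
proof -
  have "\<forall>\<^sub>F n in sequentially. y $ i \<noteq> 0 \<longrightarrow> Y n $ i \<noteq> 0" for i
  proof (cases "y $ i = 0")
    case False
    have "(\<lambda>n. Y n $ i) \<longlonglongrightarrow> y $ i" using assms by (rule tendsto_vec_nth)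
    from tendsto_imp_eventually_ne[OF this False] show ?thesis by (auto elim: eventually_mono)
  qed simp
  then have "\<forall>\<^sub>F n in sequentially. \<forall>i. y $ i \<noteq> 0 \<longrightarrow> Y n $ i \<noteq> 0"
    by (simp add: eventually_all_finite)
  then show ?thesis by (auto elim: eventually_mono)
qed

text \<open>Where the coordinates of \<open>x\<close> are at most \<open>R\<close>, every exponent can be replaced by one that vanishes
  in all coordinates with \<open>x\<^sub>i \<le> - M\<close>, without decreasing the penalised pairing.  Otherwise there
  are \<open>X\<^sub>n\<close> and \<open>Y\<^sub>n \<in> P\<close> violating this with \<open>M = n\<close>; a limit point \<open>y\<close> of \<open>Y\<^sub>n\<close> vanishes in
  the required coordinates (comparing with the exponent \<open>0\<close>), has strictly more zeros than \<open>Y\<^sub>n\<close>,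
  and \<open>X\<^sub>n \<bullet> (Y\<^sub>n - y)\<close> is eventually less than \<open>1\<close>, so \<open>y\<close> is a valid replacement after all.
  The bound \<open>M\<close> is uniform in coordinates tending to \<open>-\<infinity>\<close>, so it serves all coordinate
  strata at once.\<close>

lemma reduce_exponent:
  fixes P :: "(real^'d) set"
  assumes cpt: "compact P" and orth: "P \<subseteq> nonneg_orthant" and zero: "0 \<in> P" and R: "0 \<le> R"
  shows "\<exists>M\<ge>0. \<forall>x. (\<forall>i. x $ i \<le> R) \<longrightarrow> (\<forall>y\<in>P. \<exists>y'\<in>P. (\<forall>i. x $ i \<le> - M \<longrightarrow> y' $ i = 0) \<and>
    x \<bullet> y + real (zero_count y) \<le> x \<bullet> y' + real (zero_count y'))"
proof (rule ccontr)
  assume "\<not> ?thesis"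
  then have "\<forall>n. \<exists>x y. (\<forall>i. x $ i \<le> R) \<and> y \<in> P \<and>
      (\<forall>y'\<in>P. (\<forall>i. x $ i \<le> - real n \<longrightarrow> y' $ i = 0) \<longrightarrow>
        x \<bullet> y' + real (zero_count y') < x \<bullet> y + real (zero_count y))"
    by (meson not_less of_nat_0_le_iff)
  then obtain X Y where X: "\<And>n i. X n $ i \<le> R" and Y: "\<And>n. Y n \<in> P" and
    bad: "\<And>n y'. y' \<in> P \<Longrightarrow> (\<forall>i. X n $ i \<le> - real n \<longrightarrow> y' $ i = 0) \<Longrightarrow>
        X n \<bullet> y' + real (zero_count y') < X n \<bullet> Y n + real (zero_count (Y n))"
    by metis
  obtain y r where y: "y \<in> P" and r: "strict_mono r" and lim: "(Y \<circ> r) \<longlonglongrightarrow> y"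
    using cpt Y unfolding compact_def by metis
  have limi: "(\<lambda>n. Y (r n) $ i) \<longlonglongrightarrow> y $ i" for i
    using tendsto_vec_nth[OF lim, of i] by (simp add: o_def)
  have Y0: "0 \<le> Y n $ i" for n i using Y orth by (auto simp: nonneg_orthant_def)
  have y0: "0 \<le> y $ i" for i using y orth by (auto simp: nonneg_orthant_def)
  obtain B where B: "\<And>z. z \<in> P \<Longrightarrow> norm z \<le> B"
    using compact_imp_bounded[OF cpt] by (auto simp: bounded_iff)
  have YB: "Y n $ i \<le> B" for n i
    using B[OF Y[of n]] component_le_norm_cart[of "Y n" i] by simp
  have B0: "0 \<le> B" using B[OF zero] by simp
  \<comment> \<open>comparison with the exponent \<open>0\<close>\<close>
  have pos: "0 \<le> X n \<bullet> Y n" for n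
  proof -
    have "real CARD('d) < X n \<bullet> Y n + real (zero_count (Y n))"
      using bad[OF zero, of n] by (simp add: zero_count_def)
    then show ?thesis using zero_count_le[of "Y n"] by simp
  qed
  define K where "K = real CARD('d) * (R * B)"
  have coord: "- K \<le> X n $ i * Y n $ i" for n i
  proof -
    have "X n $ j * Y n $ j \<le> R * B" for j
      by (meson X YB Y0 R mult_mono order_trans mult_right_mono mult_left_mono)
    then have "(\<Sum>j\<in>UNIV - {i}. X n $ j * Y n $ j) \<le> real (card (UNIV - {i})) * (R * B)"
      by (intro sum_bounded_above)
    also have "\<dots> \<le> K" unfolding K_def
      using R B0 by (intro mult_right_mono) (auto intro: card_mono)
    finally show ?thesis using pos[of n]
      by (simp add: inner_vec_def sum.remove[of UNIV i])
  qed
  \<comment> \<open>where the limit exponent is positive, the coordinates of \<open>X n\<close> are bounded below\<close>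
  have bdd: "\<exists>A\<ge>0. \<forall>\<^sub>F n in sequentially. - A \<le> X (r n) $ i" if "y $ i \<noteq> 0" for i
  proof -
    have yi: "0 < y $ i" using y0[of i] that by simp
    have "\<forall>\<^sub>F n in sequentially. y $ i / 2 < Y (r n) $ i"
      using order_tendstoD(1)[OF limi, of "y $ i / 2" i] yi by simp
    then have "\<forall>\<^sub>F n in sequentially. - (2 * K / y $ i) \<le> X (r n) $ i"
    proof (rule eventually_mono)
      fix n assume n: "y $ i / 2 < Y (r n) $ i"
      show "- (2 * K / y $ i) \<le> X (r n) $ i"
      proof (rule ccontr)
        assume c: "\<not> - (2 * K / y $ i) \<le> X (r n) $ i"
        have "0 \<le> K" using R B0 by (simp add: K_def)
        then have neg: "X (r n) $ i < 0" using c yi by (smt (verit) divide_nonneg_pos)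
        have "X (r n) $ i * Y (r n) $ i \<le> X (r n) $ i * (y $ i / 2)"
          using neg n by (intro mult_left_mono_neg) auto
        also have "\<dots> < - K" using c yi by (simp add: field_simps)
        finally show False using coord[of "r n" i] by simp
      qed
    qed
    moreover have "0 \<le> 2 * K / y $ i" using R B0 yi by (simp add: K_def)
    ultimately show ?thesis by blast
  qed
  have ev1: "\<forall>\<^sub>F n in sequentially. \<forall>i. X (r n) $ i \<le> - real (r n) \<longrightarrow> y $ i = 0"
  proof -
    have "\<forall>\<^sub>F n in sequentially. X (r n) $ i \<le> - real (r n) \<longrightarrow> y $ i = 0" for i
    proof (cases "y $ i = 0")
      case False
      then obtain A where A: "\<forall>\<^sub>F n in sequentially. - A \<le> X (r n) $ i" using bdd by blast
      have "\<forall>\<^sub>F n in sequentially. A < real n"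
        using filterlim_real_sequentially by (simp add: filterlim_at_top_dense)
      with A show ?thesis
      proof eventually_elim
        case (elim n)
        then show ?case using seq_suble[OF r, of n] by linarith
      qed
    qed simp
    then show ?thesis by (simp add: eventually_all_finite)
  qed
  have ev2: "\<forall>\<^sub>F n in sequentially. X (r n) \<bullet> (Y (r n) - y) < 1"
  proof -
    have each: "\<forall>\<^sub>F n in sequentially. X (r n) $ i * (Y (r n) $ i - y $ i) < 1 / real CARD('d)" for i
    proof -
      obtain A where A: "0 \<le> A" and
        ev: "\<forall>\<^sub>F n in sequentially. X (r n) $ i * (Y (r n) $ i - y $ i) \<le> A * \<bar>Y (r n) $ i - y $ i\<bar>"
      proof (cases "y $ i = 0")
        case True
        have "X (r n) $ i * (Y (r n) $ i - y $ i) \<le> R * \<bar>Y (r n) $ i - y $ i\<bar>" for n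
          using True Y0 X by (auto intro: mult_right_mono)
        then show thesis using that[of R] R by simp
      next
        case False
        then obtain A where A: "0 \<le> A" "\<forall>\<^sub>F n in sequentially. - A \<le> X (r n) $ i" using bdd by blast
        have "\<forall>\<^sub>F n in sequentially.
            X (r n) $ i * (Y (r n) $ i - y $ i) \<le> (A + R) * \<bar>Y (r n) $ i - y $ i\<bar>"
          using A(2)
        proof eventually_elim
          case (elim n)
          then have "\<bar>X (r n) $ i\<bar> \<le> A + R" using X[of "r n" i] A R by linarith
          then have "\<bar>X (r n) $ i * (Y (r n) $ i - y $ i)\<bar> \<le> (A + R) * \<bar>Y (r n) $ i - y $ i\<bar>"
            unfolding abs_mult by (intro mult_right_mono) auto
          then show ?case by linarith
        qed
        then show thesis using that[of "A + R"] A R by simp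
      qed
      have "(\<lambda>n. A * \<bar>Y (r n) $ i - y $ i\<bar>) \<longlonglongrightarrow> A * \<bar>y $ i - y $ i\<bar>"
        by (intro tendsto_intros limi)
      then have "\<forall>\<^sub>F n in sequentially. A * \<bar>Y (r n) $ i - y $ i\<bar> < 1 / real CARD('d)"
        by (rule order_tendstoD) simp
      with ev show ?thesis by eventually_elim linarith
    qed
    then have "\<forall>\<^sub>F n in sequentially. \<forall>i. X (r n) $ i * (Y (r n) $ i - y $ i) < 1 / real CARD('d)"
      by (simp add: eventually_all_finite)
    then show ?thesis
    proof eventually_elim
      case (elim n)
      have "X (r n) \<bullet> (Y (r n) - y) = (\<Sum>i\<in>UNIV. X (r n) $ i * (Y (r n) $ i - y $ i))"
        by (simp add: inner_vec_def)
      also have "\<dots> < (\<Sum>i\<in>(UNIV :: 'd set). 1 / real CARD('d))"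
        using elim by (intro sum_strict_mono) auto
      finally show ?case by simp
    qed
  qed
  have ev3: "\<forall>\<^sub>F n in sequentially. {i. Y (r n) $ i = 0} \<subseteq> {i. y $ i = 0}"
    using eventually_zero_set_subset[OF lim] by (simp add: o_def)
  obtain n where n: "\<forall>i. X (r n) $ i \<le> - real (r n) \<longrightarrow> y $ i = 0"
    "X (r n) \<bullet> (Y (r n) - y) < 1" "{i. Y (r n) $ i = 0} \<subseteq> {i. y $ i = 0}"
    using eventually_happens[OF eventually_conj[OF ev1 eventually_conj[OF ev2 ev3]]] by auto
  have "\<exists>i. X (r n) $ i \<le> - real (r n) \<and> Y (r n) $ i \<noteq> 0"
    using bad[OF Y[of "r n"], of "r n"] by auto
  then have "{i. Y (r n) $ i = 0} \<subset> {i. y $ i = 0}" using n by auto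
  then have "zero_count (Y (r n)) < zero_count y"
    unfolding zero_count_def by (intro psubset_card_mono) auto
  then have "X (r n) \<bullet> Y (r n) + real (zero_count (Y (r n))) \<le> X (r n) \<bullet> y + real (zero_count y)"
    using n(2) by (simp add: inner_diff_right)
  then show False using bad[OF y n(1)] by simp
qed

context
  fixes P :: "(real^'d) set"
  assumes bounded: "bounded P" and nonempty: "P \<noteq> {}"
begin

lemma penalised_support_bdd_above: "bdd_above ((\<lambda>y. x \<bullet> y + real (zero_count y)) ` P)"
proof -
  obtain B where B: "\<And>y. y \<in> P \<Longrightarrow> norm y \<le> B"
    using bounded by (auto simp: bounded_iff)
  have "x \<bullet> y + real (zero_count y) \<le> norm x * B + real CARD('d)" if "y \<in> P" for y
    using norm_cauchy_schwarz[of x y] mult_left_mono[OF B[OF that], of "norm x"]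
      zero_count_le[of y] by simp
  then show ?thesis by (intro bdd_aboveI2)
qed

lemma penalised_support_ge:
  "y \<in> P \<Longrightarrow> x \<bullet> y + real (zero_count y) \<le> penalised_support P x"
  unfolding penalised_support_def by (rule cSUP_upper[OF _ penalised_support_bdd_above])

lemma penalised_support_le:
  "(\<And>y. y \<in> P \<Longrightarrow> x \<bullet> y + real (zero_count y) \<le> c) \<Longrightarrow> penalised_support P x \<le> c"
  unfolding penalised_support_def by (rule cSUP_least[OF nonempty])

lemma penalised_support_convex: "convex_on UNIV (penalised_support P)"
proof (rule convex_onI)
  fix t :: real and x x' :: "real^'d" assume t: "0 < t" "t < 1"
  show "penalised_support P ((1 - t) *\<^sub>R x + t *\<^sub>R x')
    \<le> (1 - t) * penalised_support P x + t * penalised_support P x'"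
  proof (rule penalised_support_le)
    fix y assume y: "y \<in> P"
    have "(1 - t) * (x \<bullet> y + real (zero_count y)) + t * (x' \<bullet> y + real (zero_count y))
      \<le> (1 - t) * penalised_support P x + t * penalised_support P x'"
      using t by (intro add_mono mult_left_mono penalised_support_ge y) auto
    then show "((1 - t) *\<^sub>R x + t *\<^sub>R x') \<bullet> y + real (zero_count y)
      \<le> (1 - t) * penalised_support P x + t * penalised_support P x'"
      by (simp add: inner_add_left algebra_simps)
  qed
qed simp

lemma penalised_support_lipschitz:
  "\<exists>L\<ge>0. \<forall>x x'. \<bar>penalised_support P x - penalised_support P x'\<bar> \<le> L * norm (x - x')"
proof -
  obtain B where B: "\<And>y. y \<in> P \<Longrightarrow> norm y \<le> B"
    using bounded by (auto simp: bounded_iff)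
  have B0: "0 \<le> B" using nonempty B norm_ge_zero order_trans by blast
  have 1: "penalised_support P x \<le> penalised_support P x' + B * norm (x - x')" for x x'
  proof (rule penalised_support_le)
    fix y assume y: "y \<in> P"
    have "(x - x') \<bullet> y \<le> norm (x - x') * B"
      using norm_cauchy_schwarz[of "x - x'" y] mult_left_mono[OF B[OF y], of "norm (x - x')"] by simp
    then show "x \<bullet> y + real (zero_count y) \<le> penalised_support P x' + B * norm (x - x')"
      using penalised_support_ge[OF y, of x'] by (simp add: inner_diff_left mult.commute)
  qed
  have "\<bar>penalised_support P x - penalised_support P x'\<bar> \<le> B * norm (x - x')" for x x'
    using 1[of x x'] 1[of x' x] by (simp add: norm_minus_commute abs_le_iff algebra_simps)
  then show ?thesis using B0 by blast
qed

end

text \<open>Two points of \<open>\<real>\<^sup>d\<close>, with coordinates at most \<open>R\<close>, that agree except in coordinates where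
  both are at most \<open>- M\<close>.\<close>

definition agree_above :: "real \<Rightarrow> real \<Rightarrow> real^'d \<Rightarrow> real^'d \<Rightarrow> bool" where
  "agree_above R M x x' \<longleftrightarrow> (\<forall>i. x $ i \<le> R \<and> x' $ i \<le> R \<and>
     (x $ i = x' $ i \<or> x $ i \<le> - M \<and> x' $ i \<le> - M))"

lemma penalised_support_local:
  fixes P :: "(real^'d) set"
  assumes cpt: "compact P" and orth: "P \<subseteq> nonneg_orthant" and zero: "0 \<in> P" and R: "0 \<le> R"
  shows "\<exists>M\<ge>0. \<forall>x x'. agree_above R M x x' \<longrightarrow> penalised_support P x = penalised_support P x'"
proof -
  note b = compact_imp_bounded[OF cpt]
  have ne: "P \<noteq> {}" using zero by blast
  obtain M where M: "0 \<le> M" "\<And>x y. (\<forall>i. x $ i \<le> R) \<Longrightarrow> y \<in> P \<Longrightarrow> \<exists>y'\<in>P.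
    (\<forall>i. x $ i \<le> - M \<longrightarrow> y' $ i = 0) \<and>
    x \<bullet> y + real (zero_count y) \<le> x \<bullet> y' + real (zero_count y')"
    using reduce_exponent[OF assms] by metis
  have le: "penalised_support P x \<le> penalised_support P x'" if a: "agree_above R M x x'" for x x'
  proof (rule penalised_support_le[OF b ne])
    fix y assume y: "y \<in> P"
    have "\<forall>i. x $ i \<le> R" using a by (auto simp: agree_above_def)
    from M(2)[OF this y] obtain y' where y': "y' \<in> P" "\<And>i. x $ i \<le> - M \<Longrightarrow> y' $ i = 0"
      "x \<bullet> y + real (zero_count y) \<le> x \<bullet> y' + real (zero_count y')" by blast
    have "x $ i * y' $ i = x' $ i * y' $ i" for i
      using a y'(2)[of i] by (cases "x $ i = x' $ i") (auto simp: agree_above_def)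
    then have "x \<bullet> y' = x' \<bullet> y'" unfolding inner_vec_def by (intro sum.cong) (simp_all only: inner_real_def)
    then show "x \<bullet> y + real (zero_count y) \<le> penalised_support P x'"
      using y'(3) penalised_support_ge[OF b ne y'(1), of x'] by simp
  qed
  have "agree_above R M x' x" if "agree_above R M x x'" for x x' :: "real^'d"
    using that unfolding agree_above_def by metis
  then show ?thesis using le M(1) by (meson order_antisym)
qed

section \<open>Positivity of the Levi form by comparison from below\<close>

text \<open>A minorant \<open>h\<close> of \<open>u\<close> along a line, touching \<open>u\<close> at \<open>z\<close>, bounds the second derivative from below.\<close>

lemma second_derivative_ge:
  fixes u :: "'a::euclidean_space \<Rightarrow> real"
  assumes u: "C2_on UNIV u"
    and le: "\<forall>\<^sub>F t in nhds 0. h t \<le> u (z + t *\<^sub>R w)" and eq: "h 0 = u z"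
    and h: "\<forall>\<^sub>F t in nhds 0. (h has_real_derivative h' t) (at t)"
    and h': "(h' has_real_derivative c) (at 0)"
  shows "c \<le> second_derivative u z w w"
proof (rule ccontr)
  assume c: "\<not> ?thesis"
  obtain d where d: "0 < d" "\<And>t. \<bar>t\<bar> < d \<Longrightarrow> h t \<le> u (z + t *\<^sub>R w)"
    "\<And>t. \<bar>t\<bar> < d \<Longrightarrow> (h has_real_derivative h' t) (at t)"
    using eventually_conj[OF le h] unfolding eventually_nhds_metric by (auto simp: dist_real_def)
  define g where "g t = u (z + t *\<^sub>R w) - h t" for t
  define g' where "g' t = frechet_derivative u (at (z + t *\<^sub>R w)) w - h' t" for t
  have g: "(g has_real_derivative g' t) (at t)" if "\<bar>t\<bar> < d" for t
    unfolding g_def g'_def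
    by (intro DERIV_diff C2_has_real_derivative_along(1)[OF u] has_vector_derivative_line d(3) that)
  have g': "(g' has_real_derivative second_derivative u z w w - c) (at 0)"
  proof -
    have "((\<lambda>t. frechet_derivative u (at (z + t *\<^sub>R w)) w) has_real_derivative
        second_derivative u (z + 0 *\<^sub>R w) w w) (at 0)"
      by (rule C2_has_real_derivative_along(2)[OF u has_vector_derivative_line])
    from DERIV_diff[OF this h'] show ?thesis by (simp add: g'_def[abs_def])
  qed
  have "g' 0 = 0"
    using DERIV_local_min[OF g[of 0] d(1)] d eq by (auto simp: g_def)
  moreover obtain e where e: "0 < e" "\<And>t. 0 < t \<Longrightarrow> t < e \<Longrightarrow> g' (0 + t) < g' 0"
    using DERIV_neg_dec_right[OF g'] c by auto
  define s where "s = min d e / 2"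
  have s: "0 < s" "s < d" "s < e" using d(1) e(1) by (auto simp: s_def)
  obtain t where t: "0 < t" "t < s" "g s - g 0 = (s - 0) * g' t"
    using MVT2[OF s(1), of g g'] g s by auto
  ultimately have "g s - g 0 < 0"
    using e(2)[of t] s by (simp add: mult_pos_neg)
  moreover have "g 0 = 0" "0 \<le> g s" using eq d(2)[of s] s by (auto simp: g_def)
  ultimately show False by simp
qed

lemma ln_cmod_has_derivative:
  assumes "a + of_real t * c \<noteq> 0"
  shows "((\<lambda>t. ln (cmod (a + of_real t * c))) has_real_derivative Re (c / (a + of_real t * c))) (at t)"
proof -
  let ?r = "\<lambda>t. (Re a + t * Re c)\<^sup>2 + (Im a + t * Im c)\<^sup>2"
  have pos: "0 < ?r t"
    using assms by (auto simp: complex_eq_iff sum_power2_gt_zero_iff)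
  have "ln (cmod (a + of_real t * c)) = ln (?r t) / 2" for t
    by (simp add: cmod_def ln_sqrt)
  moreover have "((\<lambda>t. ln (?r t) / 2) has_real_derivative Re (c / (a + of_real t * c))) (at t)"
  proof -
    have "(?r has_real_derivative 2 * (Re a + t * Re c) * Re c + 2 * (Im a + t * Im c) * Im c) (at t)"
      by (auto intro!: derivative_eq_intros simp: algebra_simps)
    from DERIV_cdivide[OF DERIV_chain2[OF DERIV_ln_divide[OF pos] this], of 2]
    have "((\<lambda>t. ln (?r t) / 2) has_real_derivative 1 / ?r t *
        (2 * (Re a + t * Re c) * Re c + 2 * (Im a + t * Im c) * Im c) / 2) (at t)" .
    also have "1 / ?r t * (2 * (Re a + t * Re c) * Re c + 2 * (Im a + t * Im c) * Im c) / 2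
        = Re (c / (a + of_real t * c))"
    proof -
      have "1 / r * (2 * A * B + 2 * C * D) / 2 = (B * A + D * C) / r" for A B C D r :: real
        by (cases "r = 0") (auto simp: field_simps)
      then show ?thesis by (simp only: Re_divide) simp
    qed
    finally show ?thesis .
  qed
  ultimately show ?thesis by (simp only:)
qed

lemma Re_divide_has_derivative:
  assumes "a \<noteq> 0"
  shows "((\<lambda>t. Re (c / (a + of_real t * c))) has_real_derivative - Re ((c / a)\<^sup>2)) (at 0)"
proof -
  have "((\<lambda>s. c / (a + s * c)) has_field_derivative - ((c / a)\<^sup>2)) (at (of_real 0))"
    using assms by (auto intro!: derivative_eq_intros simp: power2_eq_square)
  from has_vector_derivative_real_field[OF this]
  have "((\<lambda>t. c / (a + of_real t * c)) has_vector_derivative - ((c / a)\<^sup>2)) (at 0)"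
    by simp
  from bounded_linear.has_vector_derivative[OF bounded_linear_Re this]
  show ?thesis by (simp add: has_real_derivative_iff_has_vector_derivative)
qed

lemma norm_line:
  fixes z w :: "'a::real_inner"
  shows "(norm (z + t *\<^sub>R w))\<^sup>2 = z \<bullet> z + 2 * t * (z \<bullet> w) + t\<^sup>2 * (w \<bullet> w)"
  unfolding power2_norm_eq_inner
  by (simp add: inner_add_left inner_add_right inner_commute power2_eq_square algebra_simps)

lemma ln_norm_has_derivative:
  fixes z w :: "'a::real_inner"
  defines "S \<equiv> \<lambda>t. 1 + (norm (z + t *\<^sub>R w))\<^sup>2"
  shows "((\<lambda>t. ln (S t)) has_real_derivative (2 * (z \<bullet> w) + 2 * t * (w \<bullet> w)) / S t) (at t)"
    and "((\<lambda>t. (2 * (z \<bullet> w) + 2 * t * (w \<bullet> w)) / S t) has_real_derivative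
      2 * (w \<bullet> w) / (1 + z \<bullet> z) - (2 * (z \<bullet> w))\<^sup>2 / (1 + z \<bullet> z)\<^sup>2) (at 0)"
proof -
  have pos: "0 < S t" for t unfolding S_def by (smt (verit) zero_le_power2)
  have S': "(S has_real_derivative 2 * (z \<bullet> w) + 2 * t * (w \<bullet> w)) (at t)" for t
    unfolding S_def norm_line by (auto intro!: derivative_eq_intros)
  show "((\<lambda>t. ln (S t)) has_real_derivative (2 * (z \<bullet> w) + 2 * t * (w \<bullet> w)) / S t) (at t)"
    using DERIV_chain2[OF DERIV_ln_divide[OF pos] S'] by simp
  have S0: "S 0 = 1 + z \<bullet> z" by (simp add: S_def power2_norm_eq_inner)
  have nz: "1 + z \<bullet> z \<noteq> 0" using pos[of 0] S0 by simp
  have "((\<lambda>t. 2 * (z \<bullet> w) + 2 * t * (w \<bullet> w)) has_real_derivative 2 * (w \<bullet> w)) (at 0)"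
    by (auto intro!: derivative_eq_intros)
  from DERIV_divide[OF this S'[of 0]] pos[of 0]
  show "((\<lambda>t. (2 * (z \<bullet> w) + 2 * t * (w \<bullet> w)) / S t) has_real_derivative
      2 * (w \<bullet> w) / (1 + z \<bullet> z) - (2 * (z \<bullet> w))\<^sup>2 / (1 + z \<bullet> z)\<^sup>2) (at 0)"
    using nz by (simp add: S0 diff_divide_distrib power2_eq_square)
qed

lemma inner_i_smult:
  fixes w :: "complex^'d"
  shows "(\<i> *s w) \<bullet> (\<i> *s w) = w \<bullet> w" "w \<bullet> (\<i> *s w) = 0"
  by (simp_all add: inner_vec_def inner_complex_def add.commute mult.commute)

text \<open>The Cauchy--Schwarz inequality for the Hermitian product, whose real and imaginary parts are, up to
  sign, \<open>z \<bullet> w\<close> and \<open>z \<bullet> \<i> w\<close>.\<close>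

lemma complex_cauchy_schwarz:
  fixes z w :: "complex^'d"
  shows "(z \<bullet> w)\<^sup>2 + (z \<bullet> (\<i> *s w))\<^sup>2 \<le> (z \<bullet> z) * (w \<bullet> w)"
proof -
  define a where "a = z \<bullet> w"
  define b where "b = z \<bullet> (\<i> *s w)"
  let ?v = "a *\<^sub>R w + b *\<^sub>R (\<i> *s w)"
  have "z \<bullet> ?v = a\<^sup>2 + b\<^sup>2"
    by (simp add: inner_add_right a_def b_def power2_eq_square)
  moreover have "?v \<bullet> ?v = (a\<^sup>2 + b\<^sup>2) * (w \<bullet> w)"
    using inner_i_smult[of w]
    by (simp add: inner_add_left inner_add_right inner_commute[of "\<i> *s w" w] power2_eq_square
        algebra_simps)
  ultimately have "(a\<^sup>2 + b\<^sup>2) * (a\<^sup>2 + b\<^sup>2) \<le> (a\<^sup>2 + b\<^sup>2) * ((z \<bullet> z) * (w \<bullet> w))"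
    using Cauchy_Schwarz_ineq[of z ?v] by (simp add: power2_eq_square algebra_simps)
  moreover have "0 \<le> (z \<bullet> z) * (w \<bullet> w)" by simp
  ultimately show ?thesis unfolding a_def[symmetric] b_def[symmetric]
    by (smt (verit) mult_left_le_imp_le sum_power2_ge_zero)
qed

lemma eventually_along_line:
  fixes z :: "'a::real_normed_vector"
  assumes "\<forall>\<^sub>F x in nhds z. Q x"
  shows "\<forall>\<^sub>F t in nhds (0::real). Q (z + t *\<^sub>R w)"
proof -
  have "isCont (\<lambda>t::real. z + t *\<^sub>R w) 0" by (intro continuous_intros)
  then have "filterlim (\<lambda>t::real. z + t *\<^sub>R w) (nhds z) (nhds 0)"
    using tendsto_at_iff_tendsto_nhds[of "\<lambda>t::real. z + t *\<^sub>R w" 0] by (simp add: isCont_def)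
  then show ?thesis using assms by (simp add: filterlim_iff)
qed

text \<open>The function \<open>log |x\<^sub>i|\<close> is pluriharmonic off \<open>x\<^sub>i = 0\<close>; the sum is restricted to the
  coordinates that do not vanish at the point of contact \<open>z\<close>.\<close>

lemma levi_pos:
  fixes u :: "complex^'d \<Rightarrow> real"
  assumes u: "C2_on UNIV u" and b: "0 < b" and w: "w \<noteq> 0"
    and le: "\<forall>\<^sub>F x in nhds z. c + (\<Sum>i | z $ i \<noteq> 0. a i * ln (cmod (x $ i)))
      + b * ln (1 + (norm x)\<^sup>2) \<le> u x"
    and eq: "c + (\<Sum>i | z $ i \<noteq> 0. a i * ln (cmod (z $ i))) + b * ln (1 + (norm z)\<^sup>2) = u z"
  shows "0 < levi u z w"
proof -
  let ?S = "1 + z \<bullet> z"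
  define lower where "lower v = (\<Sum>i | z $ i \<noteq> 0. a i * - Re ((v $ i / z $ i)\<^sup>2))
    + b * (2 * (v \<bullet> v) / ?S - (2 * (z \<bullet> v))\<^sup>2 / ?S\<^sup>2)" for v
  have lower: "lower v \<le> second_derivative u z v v" for v
  proof (rule second_derivative_ge[OF u])
    let ?h = "\<lambda>t::real. c + (\<Sum>i | z $ i \<noteq> 0. a i * ln (cmod (z $ i + of_real t * v $ i)))
      + b * ln (1 + (norm (z + t *\<^sub>R v))\<^sup>2)"
    let ?h' = "\<lambda>t::real. (\<Sum>i | z $ i \<noteq> 0. a i * Re (v $ i / (z $ i + of_real t * v $ i)))
      + b * ((2 * (z \<bullet> v) + 2 * t * (v \<bullet> v)) / (1 + (norm (z + t *\<^sub>R v))\<^sup>2))"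
    show "\<forall>\<^sub>F t in nhds 0. ?h t \<le> u (z + t *\<^sub>R v)"
      using eventually_along_line[OF le, of v] by (simp add: scaleR_conv_of_real[where 'a = complex])
    show "?h 0 = u z" using eq by simp
    have "\<forall>\<^sub>F t::real in nhds 0. z $ i \<noteq> 0 \<longrightarrow> z $ i + of_real t * v $ i \<noteq> 0" for i
    proof (cases "z $ i = 0")
      case False
      have "\<forall>\<^sub>F x in nhds (z $ i). x \<noteq> 0"
        using False by (intro t1_space_nhds) auto
      from eventually_along_line[OF this, of "v $ i"] show ?thesis
        by (auto simp: scaleR_conv_of_real elim: eventually_mono)
    qed simp
    then have "\<forall>\<^sub>F t::real in nhds 0. \<forall>i. z $ i \<noteq> 0 \<longrightarrow> z $ i + of_real t * v $ i \<noteq> 0"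
      by (simp add: eventually_all_finite)
    then show "\<forall>\<^sub>F t in nhds 0. (?h has_real_derivative ?h' t) (at t)"
    proof eventually_elim
      case (elim t)
      have "((\<lambda>t. (\<Sum>i | z $ i \<noteq> 0. a i * ln (cmod (z $ i + of_real t * v $ i)))
          + b * ln (1 + (norm (z + t *\<^sub>R v))\<^sup>2)) has_real_derivative ?h' t) (at t)"
        using elim by (intro DERIV_add DERIV_sum DERIV_cmult ln_norm_has_derivative
            ln_cmod_has_derivative) auto
      from DERIV_add[OF DERIV_const this, of c] show ?case by (simp add: add.assoc)
    qed
    show "(?h' has_real_derivative lower v) (at 0)"
      unfolding lower_def
      by (intro DERIV_add DERIV_sum DERIV_cmult ln_norm_has_derivative(2) Re_divide_has_derivative)
        auto
  qed
  \<comment> \<open>the pluriharmonic part cancels between \<open>w\<close> and \<open>\<i>w\<close>\<close>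
  have "(\<i> *s w) $ i / z $ i = \<i> * (w $ i / z $ i)" for i by simp
  then have "(((\<i> *s w) $ i / z $ i)\<^sup>2) = - ((w $ i / z $ i)\<^sup>2)" for i
    by (simp only: power_mult_distrib) simp
  then have sum: "lower w + lower (\<i> *s w)
      = b * (4 * (w \<bullet> w) / ?S - 4 * ((z \<bullet> w)\<^sup>2 + (z \<bullet> (\<i> *s w))\<^sup>2) / ?S\<^sup>2)"
    unfolding lower_def inner_i_smult
    by (simp add: sum_negf algebra_simps add_divide_distrib power_mult_distrib)
  have S: "0 < ?S" by (simp add: add_pos_nonneg)
  have ww: "0 < w \<bullet> w" using w by simp
  have "(z \<bullet> w)\<^sup>2 + (z \<bullet> (\<i> *s w))\<^sup>2 < (w \<bullet> w) * ?S"
  proof -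
    have "(w \<bullet> w) * ?S = w \<bullet> w + (z \<bullet> z) * (w \<bullet> w)" by (simp add: algebra_simps)
    then show ?thesis using complex_cauchy_schwarz[of z w] ww by linarith
  qed
  then have "4 * ((z \<bullet> w)\<^sup>2 + (z \<bullet> (\<i> *s w))\<^sup>2) / ?S\<^sup>2 < 4 * ((w \<bullet> w) * ?S) / ?S\<^sup>2"
    using S by (intro divide_strict_right_mono) auto
  also have "\<dots> = 4 * (w \<bullet> w) / ?S" using S by (simp add: power2_eq_square)
  finally have "0 < lower w + lower (\<i> *s w)" unfolding sum using b by simp
  then show ?thesis using lower[of w] lower[of "\<i> *s w"] by (simp add: levi_def)
qed

section \<open>Toric functions on complex space\<close>

lemma convex_above_tangent:
  fixes f :: "'a::real_normed_vector \<Rightarrow> real"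
  assumes conv: "convex_on UNIV f" and f': "(f has_derivative f') (at x)"
  shows "f x + f' (y - x) \<le> f y"
proof -
  define g where "g t = f (x + t *\<^sub>R (y - x))" for t :: real
  have "convex_on UNIV g"
  proof (rule convex_onI)
    fix s t t' :: real assume s: "0 < s" "s < 1"
    have "x + ((1 - s) *\<^sub>R t + s *\<^sub>R t') *\<^sub>R (y - x)
      = (1 - s) *\<^sub>R (x + t *\<^sub>R (y - x)) + s *\<^sub>R (x + t' *\<^sub>R (y - x))"
      by (simp add: algebra_simps)
    then show "g ((1 - s) *\<^sub>R t + s *\<^sub>R t') \<le> (1 - s) * g t + s * g t'"
      unfolding g_def using convex_onD[OF conv, of s] s by simp
  qed simp
  moreover have "((\<lambda>t. f (x + t *\<^sub>R (y - x))) has_real_derivative f' (y - x)) (at 0)"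
  proof -
    have "((\<lambda>t::real. x + t *\<^sub>R (y - x)) has_derivative (\<lambda>h. h *\<^sub>R (y - x))) (at 0)"
      by (auto intro!: derivative_eq_intros)
    moreover have "(f has_derivative f') (at (x + 0 *\<^sub>R (y - x)))" using f' by simp
    ultimately have "((\<lambda>t. f (x + t *\<^sub>R (y - x))) has_derivative (\<lambda>h. f' (h *\<^sub>R (y - x)))) (at 0)"
      by (rule has_derivative_compose)
    moreover have "(\<lambda>h. f' (h *\<^sub>R (y - x))) = (*) (f' (y - x))"
      using has_derivative_linear[OF f'] by (auto simp: linear_scale mult.commute)
    ultimately show ?thesis by (simp add: has_field_derivative_def)
  qed
  ultimately have "f' (y - x) * (1 - 0) \<le> g 1 - g 0"
    using convex_on_imp_above_tangent[of UNIV g 0 1 "f' (y - x)"] by (simp add: g_def[abs_def])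
  then show ?thesis by (simp add: g_def)
qed

text \<open>The coordinates \<open>log |z\<^sub>i|\<close>, cut off below at \<open>- m\<close>.\<close>

definition clipped_log :: "real \<Rightarrow> complex^'d \<Rightarrow> real^'d" where
  "clipped_log m z = (\<chi> i. if z $ i = 0 then - m else max (- m) (ln (cmod (z $ i))))"

text \<open>The function \<open>f (log |z\<^sub>1|, ..., log |z\<^sub>d|)\<close>, extended to vanishing coordinates as a limit.
  For the functions \<open>f\<close> considered here the sequence is eventually constant.\<close>

definition toric :: "(real^'d \<Rightarrow> real) \<Rightarrow> complex^'d \<Rightarrow> real" where
  "toric f z = lim (\<lambda>n. f (clipped_log (real n) z))"

lemma ln_cmod_le: "w \<noteq> 0 \<Longrightarrow> cmod w \<le> exp R \<Longrightarrow> ln (cmod w) \<le> R"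
  by (metis ln_exp ln_le_cancel_iff exp_gt_zero zero_less_norm_iff)

lemma toric_eq:
  fixes f :: "real^'d \<Rightarrow> real"
  assumes M: "0 \<le> M" "\<And>x x'. agree_above R M x x' \<Longrightarrow> f x = f x'" and R: "0 \<le> R"
    and z: "\<And>i. cmod (z $ i) \<le> exp R" and m: "M \<le> m"
  shows "toric f z = f (clipped_log m z)"
proof -
  have "agree_above R M (clipped_log m' z) (clipped_log m z)" if "M \<le> m'" for m'
    using that m M(1) R ln_cmod_le[OF _ z] by (auto simp: agree_above_def clipped_log_def max_def)
  then have eq: "f (clipped_log m' z) = f (clipped_log m z)" if "M \<le> m'" for m'
    using M(2) that by blast
  have "\<forall>\<^sub>F n in sequentially. M \<le> real n"
    by (meson eventually_sequentiallyI nat_ceiling_le_eq)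
  then have "\<forall>\<^sub>F n in sequentially. f (clipped_log (real n) z) = f (clipped_log m z)"
    by (auto elim!: eventually_mono dest: eq)
  then show ?thesis unfolding toric_def by (intro limI tendsto_eventually)
qed

lemma C2_on_ln_cmod:
  fixes U :: "(complex^'d) set"
  assumes "open U" "\<And>z. z \<in> U \<Longrightarrow> z $ i \<noteq> 0"
  shows "C2_on U (\<lambda>z. ln (cmod (z $ i)))"
proof -
  have lin: "bounded_linear (\<lambda>z::complex^'d. Re (z $ i))" "bounded_linear (\<lambda>z::complex^'d. Im (z $ i))"
    by (intro bounded_linear_compose[OF bounded_linear_Re] bounded_linear_compose[OF bounded_linear_Im]
        bounded_linear_vec_nth)+
  have "C2_on U (\<lambda>z. Re (z $ i) * Re (z $ i) + Im (z $ i) * Im (z $ i))"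
    by (intro C2_on_add C2_on_mult C2_on_linear lin assms(1))
  then have "C2_on U (\<lambda>z. ln (Re (z $ i) * Re (z $ i) + Im (z $ i) * Im (z $ i)))"
  proof (rule C2_on_compose_real[OF assms(1) C2_on_ln])
    show "(\<lambda>z. Re (z $ i) * Re (z $ i) + Im (z $ i) * Im (z $ i)) ` U \<subseteq> {0<..}"
      using assms(2) by (auto simp: complex_eq_iff sum_squares_gt_zero_iff)
  qed
  from C2_on_mult[OF assms(1) C2_on_const[OF assms(1), of "1/2"] this]
  show ?thesis by (simp add: cmod_def ln_sqrt power2_eq_square)
qed

lemma C2_on_ln_norm: "C2_on UNIV (\<lambda>z::complex^'d. ln (1 + (norm z)\<^sup>2))"
proof -
  have "C2_on UNIV (\<lambda>z::complex^'d. 1 + (\<Sum>b\<in>Basis. (z \<bullet> b) * (z \<bullet> b)))"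
    by (intro C2_on_add C2_on_const C2_on_sum C2_on_mult C2_on_linear bounded_linear_inner_left open_UNIV)
  moreover have "(norm z)\<^sup>2 = (\<Sum>b\<in>Basis. (z \<bullet> b) * (z \<bullet> b))" for z :: "complex^'d"
    unfolding power2_norm_eq_inner by (rule euclidean_inner)
  ultimately have "C2_on UNIV (\<lambda>z::complex^'d. 1 + (norm z)\<^sup>2)" by simp
  then show ?thesis
    by (rule C2_on_compose_real[OF open_UNIV C2_on_ln]) (auto intro: add_pos_nonneg)
qed

text \<open>Convex functions of class \<open>C\<^sup>2\<close> which, on sets bounded above, do not depend on the value of
  coordinates close to \<open>-\<infinity>\<close>.\<close>

locale log_local =
  fixes f :: "real^'d \<Rightarrow> real"
  assumes C2: "C2_on UNIV f" and convex: "convex_on UNIV f"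
    and local: "\<And>R. 0 \<le> R \<Longrightarrow> \<exists>M\<ge>0. \<forall>x x'. agree_above R M x x' \<longrightarrow> f x = f x'"
begin

text \<open>Near \<open>z0\<close>, the coordinates that vanish at \<open>z0\<close> may be replaced by a constant, and \<open>log |z\<^sub>i|\<close> is
  smooth for the remaining ones.\<close>

lemma toric_locally:
  obtains U M where "open U" "z0 \<in> U" "\<And>z i. z \<in> U \<Longrightarrow> z0 $ i \<noteq> 0 \<Longrightarrow> z $ i \<noteq> 0"
    "\<And>z. z \<in> U \<Longrightarrow> toric f z = f (\<chi> i. if z0 $ i = 0 then - M else ln (cmod (z $ i)))"
proof -
  define R where "R = norm z0 + 1"
  have R: "0 \<le> R" by (simp add: R_def)
  obtain M where M: "0 \<le> M" "\<And>x x'. agree_above R M x x' \<Longrightarrow> f x = f x'"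
    using local[OF R] by blast
  define U where "U = ball z0 1 \<inter> (\<Inter>i. {z. if z0 $ i = 0 then cmod (z $ i) < exp (- M) else z $ i \<noteq> 0})"
  have "open {z. if z0 $ i = 0 then cmod (z $ i) < exp (- M) else z $ i \<noteq> 0}" for i
    by (cases "z0 $ i = 0") (auto intro!: open_Collect_less open_Collect_neq continuous_intros)
  then have "open U" unfolding U_def by (intro open_Int open_ball open_INT) auto
  moreover have "z0 \<in> U" by (auto simp: U_def)
  moreover have nz: "z $ i \<noteq> 0" if "z \<in> U" "z0 $ i \<noteq> 0" for z i
    using that by (auto simp: U_def split: if_splits)
  moreover have "toric f z = f (\<chi> i. if z0 $ i = 0 then - M else ln (cmod (z $ i)))"
    if z: "z \<in> U" for z
  proof -
    have zR: "cmod (z $ i) \<le> exp R" for i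
    proof -
      have "cmod (z $ i) \<le> norm z" by (rule Finite_Cartesian_Product.norm_nth_le)
      also have "\<dots> \<le> R" using z norm_triangle_sub[of z z0]
        by (simp add: U_def R_def dist_norm norm_minus_commute)
      also have "\<dots> \<le> exp R" using exp_ge_add_one_self[of R] by linarith
      finally show ?thesis .
    qed
    have small: "ln (cmod (z $ i)) \<le> - M" if "z0 $ i = 0" "z $ i \<noteq> 0" for i
    proof -
      have "\<forall>i. if z0 $ i = 0 then cmod (z $ i) < exp (- M) else z $ i \<noteq> 0"
        using z by (simp add: U_def)
      from spec[OF this, of i] show ?thesis using that by (intro ln_cmod_le) auto
    qed
    have "agree_above R M (clipped_log M z) (\<chi> i. if z0 $ i = 0 then - M else ln (cmod (z $ i)))"
      using M(1) R ln_cmod_le[OF _ zR] small nz[OF z]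
      by (auto simp: agree_above_def clipped_log_def max_def intro: order_antisym)
    then show ?thesis using toric_eq[OF M R zR order_refl] M(2) by simp
  qed
  ultimately show ?thesis using that by blast
qed

lemma toric_C2: "C2_on UNIV (toric f)"
proof (rule C2_on_locally)
  fix z0 :: "complex^'d"
  obtain U M where U: "open U" "z0 \<in> U" "\<And>z i. z \<in> U \<Longrightarrow> z0 $ i \<noteq> 0 \<Longrightarrow> z $ i \<noteq> 0"
    and eq: "\<And>z. z \<in> U \<Longrightarrow> toric f z = f (\<chi> i. if z0 $ i = 0 then - M else ln (cmod (z $ i)))"
    by (rule toric_locally[of z0]) (rule that)
  have "C2_on U (\<lambda>z. f (\<chi> i. if z0 $ i = 0 then - M else ln (cmod (z $ i))))"
  proof (rule C2_on_compose[OF U(1) C2])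
    fix b :: "real^'d" assume "b \<in> Basis"
    then obtain i where b: "b = axis i 1" by (auto simp: Basis_vec_def)
    show "C2_on U (\<lambda>z. (\<chi> i. if z0 $ i = 0 then - M else ln (cmod (z $ i))) \<bullet> b)"
    proof (cases "z0 $ i = 0")
      case True then show ?thesis by (simp add: b inner_axis C2_on_const[OF U(1)])
    next
      case False then show ?thesis using U(3) by (simp add: b inner_axis C2_on_ln_cmod[OF U(1)])
    qed
  qed simp
  then show "\<exists>U g. open U \<and> z0 \<in> U \<and> C2_on U g \<and> (\<forall>z\<in>U. toric f z = g z)"
    using U(1,2) eq by blast
qed

lemma toric_pluriharmonic_minorant:
  obtains a where "\<forall>\<^sub>F z in nhds z0.
    toric f z0 + (\<Sum>i | z0 $ i \<noteq> 0. a i * (ln (cmod (z $ i)) - ln (cmod (z0 $ i)))) \<le> toric f z"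
proof -
  obtain U M where U: "open U" "z0 \<in> U" "\<And>z i. z \<in> U \<Longrightarrow> z0 $ i \<noteq> 0 \<Longrightarrow> z $ i \<noteq> 0"
    and eq: "\<And>z. z \<in> U \<Longrightarrow> toric f z = f (\<chi> i. if z0 $ i = 0 then - M else ln (cmod (z $ i)))"
    by (rule toric_locally[of z0]) (rule that)
  define \<xi> where "\<xi> z = (\<chi> i. if z0 $ i = 0 then - M else ln (cmod (z $ i)))" for z :: "complex^'d"
  define f' where "f' = frechet_derivative f (at (\<xi> z0))"
  have f': "(f has_derivative f') (at (\<xi> z0))"
    unfolding f'_def using C2_on_has_derivative[OF C2] by blast
  have "toric f z0 + (\<Sum>i | z0 $ i \<noteq> 0. f' (axis i 1) * (ln (cmod (z $ i)) - ln (cmod (z0 $ i)))) \<le> toric f z"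
    if z: "z \<in> U" for z
  proof -
    have lin: "linear f'" using f' by (rule has_derivative_linear)
    have "\<xi> z - \<xi> z0 = (\<Sum>i\<in>UNIV. ((\<xi> z - \<xi> z0) $ i) *\<^sub>R axis i 1)"
      using basis_expansion[of "\<xi> z - \<xi> z0"] by (simp add: scalar_mult_eq_scaleR)
    then have "f' (\<xi> z - \<xi> z0) = f' (\<Sum>i\<in>UNIV. ((\<xi> z - \<xi> z0) $ i) *\<^sub>R axis i 1)"
      by (rule arg_cong)
    also have "\<dots> = (\<Sum>i\<in>UNIV. ((\<xi> z - \<xi> z0) $ i) * f' (axis i 1))"
      by (simp only: linear_sum[OF lin] linear_scale[OF lin] real_scaleR_def)
    also have "\<dots> = (\<Sum>i | z0 $ i \<noteq> 0. f' (axis i 1) * (ln (cmod (z $ i)) - ln (cmod (z0 $ i))))"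
      by (rule sum.mono_neutral_cong_right) (auto simp: \<xi>_def)
    finally show ?thesis
      using convex_above_tangent[OF convex f', of "\<xi> z"] eq[OF z] eq[OF U(2)]
      unfolding \<xi>_def[symmetric] by simp
  qed
  then have "\<forall>\<^sub>F z in nhds z0. toric f z0
      + (\<Sum>i | z0 $ i \<noteq> 0. f' (axis i 1) * (ln (cmod (z $ i)) - ln (cmod (z0 $ i)))) \<le> toric f z"
    using U by (auto simp: eventually_nhds)
  then show ?thesis by (rule that)
qed

end

lemma mollify_local:
  fixes f :: "real^'d \<Rightarrow> real"
  assumes f: "continuous_on UNIV f" and
    M: "\<And>x x'. agree_above (R + 1) M x x' \<Longrightarrow> f x = f x'" and a: "agree_above R (M + 1) x x'"
  shows "mollify f x = mollify f x'"
proof -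
  have eq: "f (x - t) = f (x' - t)" if "norm t \<le> 1" for t
  proof (rule M)
    have "\<bar>t $ i\<bar> \<le> 1" for i using component_le_norm_cart[of t i] that by linarith
    then show "agree_above (R + 1) M (x - t) (x' - t)"
      using a unfolding agree_above_def by (smt (verit) vector_minus_component)
  qed
  show ?thesis
    by (intro order_antisym mollify_mono f) (simp_all add: eq)
qed

text \<open>The tangent at \<open>(a0, b0)\<close> to the convex function \<open>(a, b) \<mapsto> log (exp a + exp b)\<close>.\<close>

lemma ln_sum_exp_minorant:
  fixes a b a0 b0 :: real
  defines "s \<equiv> exp a0 + exp b0"
  shows "ln s + exp a0 / s * (a - a0) + exp b0 / s * (b - b0) \<le> ln (exp a + exp b)"
proof -
  define p q where "p = exp a0 / s" and "q = exp b0 / s"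
  define m where "m = p * (a - a0) + q * (b - b0)"
  have s: "0 < s" by (simp add: s_def add_pos_pos)
  have pq: "0 < p" "0 < q" "p + q = 1"
    using s by (auto simp: p_def q_def s_def add_divide_distrib[symmetric])
  have e: "exp m * (1 + (x - m)) \<le> exp x" for x
    using exp_ge_add_one_self[of "x - m"] by (simp add: exp_diff field_simps)
  have "exp m * (p + q + (m - (p + q) * m)) = p * (exp m * (1 + ((a - a0) - m)))
      + q * (exp m * (1 + ((b - b0) - m)))"
    by (simp add: m_def algebra_simps)
  also have "\<dots> \<le> p * exp (a - a0) + q * exp (b - b0)"
    using pq by (intro add_mono mult_left_mono e) auto
  also have "\<dots> = (exp a + exp b) / s"
    by (simp add: p_def q_def exp_diff add_divide_distrib)
  finally have "s * exp m \<le> exp a + exp b" using s pq by (simp add: field_simps)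
  then have "ln (s * exp m) \<le> ln (exp a + exp b)" using s by (subst ln_le_cancel_iff) (auto intro: add_pos_pos)
  then show ?thesis using s by (simp add: ln_mult m_def p_def q_def)
qed

section \<open>Comparison with the logarithmic indicator function\<close>

text \<open>Vanishing coordinates contribute \<open>0\<close> to both sides: \<open>0 * -\<infinity> = 0\<close> on the right, and
  \<open>ln 0 = 0\<close> (although any value would do) on the left.\<close>

lemma log_indicator_ge:
  assumes y: "y \<in> P" and supp: "\<And>i. z $ i = 0 \<Longrightarrow> y $ i = 0"
  shows "ereal (\<Sum>i\<in>UNIV. ln (cmod (z $ i)) * y $ i) \<le> log_indicator P z"
proof -
  have "log_abs (z $ i) * ereal (y $ i) = ereal (ln (cmod (z $ i)) * y $ i)" for i
    using supp[of i] by (auto simp: log_abs_def zero_ereal_def[symmetric])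
  then have "ereal (\<Sum>i\<in>UNIV. ln (cmod (z $ i)) * y $ i)
      = (\<Sum>i\<in>UNIV. (\<chi> i. log_abs (z $ i)) $ i * ereal (y $ i))"
    by simp
  also have "\<dots> \<le> log_indicator P z"
    unfolding log_indicator_def indicator_fun_def using y by (rule SUP_upper)
  finally show ?thesis .
qed

lemma log_indicator_le_penalised_support:
  fixes P :: "(real^'d) set"
  assumes P: "bounded P" "P \<noteq> {}" "P \<subseteq> nonneg_orthant"
  shows "log_indicator P z \<le> ereal (penalised_support P (clipped_log m z))"
  unfolding log_indicator_def indicator_fun_def
proof (rule SUP_least)
  fix y assume y: "y \<in> P"
  let ?x = "clipped_log m z"
  have y0: "0 \<le> y $ i" for i using y P(3) by (auto simp: nonneg_orthant_def)
  have "log_abs (z $ i) * ereal (y $ i) \<le> ereal (?x $ i * y $ i)" for i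
  proof (cases "z $ i = 0")
    case True
    then show ?thesis using y0[of i]
      by (cases "y $ i = 0") (auto simp: log_abs_def zero_ereal_def[symmetric])
  next
    case False
    then show ?thesis using y0[of i] by (auto simp: log_abs_def clipped_log_def intro: mult_right_mono)
  qed
  then have "(\<Sum>i\<in>UNIV. (\<chi> i. log_abs (z $ i)) $ i * ereal (y $ i)) \<le> (\<Sum>i\<in>UNIV. ereal (?x $ i * y $ i))"
    by (intro sum_mono) simp
  also have "\<dots> = ereal (?x \<bullet> y)" by (simp add: inner_vec_def)
  also have "\<dots> \<le> ereal (penalised_support P ?x)"
    using penalised_support_ge[OF P(1,2) y, of ?x] by simp
  finally show "(\<Sum>i\<in>UNIV. (\<chi> i. log_abs (z $ i)) $ i * ereal (y $ i)) \<le> ereal (penalised_support P ?x)" .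
qed

lemma penalised_support_le_log_indicator:
  fixes P :: "(real^'d) set"
  assumes P: "bounded P" "P \<noteq> {}"
    and red: "\<And>y. y \<in> P \<Longrightarrow> \<exists>y'\<in>P. (\<forall>i. clipped_log m z $ i \<le> - m \<longrightarrow> y' $ i = 0) \<and>
      clipped_log m z \<bullet> y + real (zero_count y) \<le> clipped_log m z \<bullet> y' + real (zero_count y')"
    and h: "log_indicator P z = ereal h"
  shows "penalised_support P (clipped_log m z) \<le> h + real CARD('d)"
proof (rule penalised_support_le[OF P])
  let ?x = "clipped_log m z"
  fix y assume "y \<in> P"
  then obtain y' where y': "y' \<in> P" "\<And>i. ?x $ i \<le> - m \<Longrightarrow> y' $ i = 0"
    "?x \<bullet> y + real (zero_count y) \<le> ?x \<bullet> y' + real (zero_count y')"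
    using red by blast
  have supp: "z $ i = 0 \<Longrightarrow> y' $ i = 0" for i
    by (rule y'(2)) (simp add: clipped_log_def)
  have "(\<Sum>i\<in>UNIV. ln (cmod (z $ i)) * y' $ i) \<le> h"
    using log_indicator_ge[of y' P z, OF y'(1) supp] by (simp add: h)
  moreover have "?x \<bullet> y' = (\<Sum>i\<in>UNIV. ln (cmod (z $ i)) * y' $ i)"
    unfolding inner_vec_def inner_real_def
  proof (rule sum.cong)
    show "?x $ i * y' $ i = ln (cmod (z $ i)) * y' $ i" for i
      using y'(2)[of i] by (auto simp: clipped_log_def max_def split: if_splits)
  qed simp
  ultimately show "?x \<bullet> y + real (zero_count y) \<le> h + real CARD('d)"
    using y'(3) zero_count_le[of y'] by simp
qed

lemma log_indicator_nonneg:
  assumes "0 \<in> P"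
  shows "0 \<le> log_indicator P z"
  using log_indicator_ge[OF assms, of z] by (simp add: zero_ereal_def)

text \<open>The exponents \<open>0\<close> and \<open>r e\<^sub>i\<close> give \<open>H\<^sub>P \<ge> 0\<close> and \<open>H\<^sub>P(z) \<ge> r log |z\<^sub>i|\<close>, so that
  \<open>1 + |z|\<^sup>2 \<le> (1 + d) exp (2 H\<^sub>P(z) / r)\<close>.\<close>

lemma ln_norm_le_log_indicator:
  fixes P :: "(real^'d) set"
  assumes zero: "0 \<in> P" and r: "0 < r" and ax: "\<And>i. axis i r \<in> P"
    and h: "log_indicator P z = ereal h"
  shows "r / 2 * ln (1 + (norm z)\<^sup>2) \<le> h + r / 2 * ln (1 + real CARD('d))"
proof -
  have h0: "0 \<le> h" using log_indicator_nonneg[OF zero, of z] by (simp add: h)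
  have "(cmod (z $ i))\<^sup>2 \<le> exp (2 / r * h)" for i
  proof (cases "z $ i = 0")
    case False
    have "ereal (\<Sum>j\<in>UNIV. ln (cmod (z $ j)) * axis i r $ j) \<le> log_indicator P z"
      by (rule log_indicator_ge[OF ax]) (use False in \<open>auto simp: axis_def\<close>)
    moreover have "(\<Sum>j\<in>UNIV. ln (cmod (z $ j)) * axis i r $ j) = ln (cmod (z $ i)) * r"
      by (simp add: axis_def if_distrib cong: if_cong)
    ultimately have "ln (cmod (z $ i)) * r \<le> h" by (simp add: h)
    then have "2 * ln (cmod (z $ i)) \<le> 2 / r * h" using r by (simp add: field_simps)
    moreover have "(cmod (z $ i))\<^sup>2 = exp (2 * ln (cmod (z $ i)))"
      using False by (simp add: exp_double)
    ultimately show ?thesis by simp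
  qed simp
  then have "(\<Sum>i\<in>UNIV. (cmod (z $ i))\<^sup>2) \<le> real (card (UNIV :: 'd set)) * exp (2 / r * h)"
    by (intro sum_bounded_above) auto
  moreover have "(norm z)\<^sup>2 = (\<Sum>i\<in>UNIV. (cmod (z $ i))\<^sup>2)"
    by (simp add: norm_vec_def L2_set_def sum_nonneg)
  moreover have "1 \<le> exp (2 / r * h)" using h0 r by simp
  ultimately have "1 + (norm z)\<^sup>2 \<le> (1 + real CARD('d)) * exp (2 / r * h)"
    unfolding distrib_right by linarith
  then have "ln (1 + (norm z)\<^sup>2) \<le> ln ((1 + real CARD('d)) * exp (2 / r * h))"
    by (subst ln_le_cancel_iff) (auto intro!: add_pos_nonneg mult_pos_pos)
  also have "\<dots> = ln (1 + real CARD('d)) + 2 / r * h"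
    by (subst ln_mult) (auto simp: add_pos_nonneg)
  finally have "r / 2 * ln (1 + (norm z)\<^sup>2) \<le> r / 2 * (ln (1 + real CARD('d)) + 2 / r * h)"
    using r by (intro mult_left_mono) auto
  then show ?thesis using r by (simp add: algebra_simps)
qed

text \<open>The only contributions to the difference from \<open>H\<^sub>P\<close> are the bonus, at most \<open>d\<close>, and the
  mollification, at most the Lipschitz constant of the penalised support function.\<close>

lemma toric_mollified_support:
  fixes P :: "(real^'d) set"
  assumes cpt: "compact P" and orth: "P \<subseteq> nonneg_orthant" and zero: "0 \<in> P"
  defines "f \<equiv> mollify (penalised_support P)"
  shows "log_local f"
    and "\<exists>C. \<forall>z. \<exists>h. log_indicator P z = ereal h \<and> \<bar>toric f z - h\<bar> \<le> C"
proof -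
  note b = compact_imp_bounded[OF cpt]
  have ne: "P \<noteq> {}" using zero by blast
  obtain L where L: "0 \<le> L"
    "\<And>x x'. \<bar>penalised_support P x - penalised_support P x'\<bar> \<le> L * norm (x - x')"
    using penalised_support_lipschitz[OF b ne] by blast
  have cont: "continuous_on UNIV (penalised_support P)"
    by (rule lipschitz_on_continuous_on[of L]) (auto simp: lipschitz_on_def dist_norm L)
  show loc: "log_local f"
  proof
    show "C2_on UNIV f" unfolding f_def by (rule mollify_C2[OF cont])
    show "convex_on UNIV f"
      unfolding f_def by (rule mollify_convex[OF cont penalised_support_convex[OF b ne]])
    fix R :: real assume "0 \<le> R"
    then obtain M where M: "0 \<le> M" "\<And>x x'. agree_above (R + 1) M x x' \<Longrightarrow>
        penalised_support P x = penalised_support P x'"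
      using penalised_support_local[OF cpt orth zero, of "R + 1"] by auto
    show "\<exists>M\<ge>0. \<forall>x x'. agree_above R M x x' \<longrightarrow> f x = f x'"
      unfolding f_def using M(1) mollify_local[OF cont M(2)] by (intro exI[of _ "M + 1"]) auto
  qed
  have "\<exists>h. log_indicator P z = ereal h \<and> \<bar>toric f z - h\<bar> \<le> L + real CARD('d)" for z
  proof -
    define R where "R = norm z"
    have R: "0 \<le> R" by (simp add: R_def)
    have zR: "cmod (z $ i) \<le> exp R" for i
      using Finite_Cartesian_Product.norm_nth_le[of z i] exp_ge_add_one_self[of R]
      unfolding R_def by linarith
    obtain M1 where M1: "0 \<le> M1" "\<And>x x'. agree_above R M1 x x' \<Longrightarrow> f x = f x'"
      using log_local.local[OF loc R] by blast
    obtain M2 where M2: "0 \<le> M2" "\<And>x y. (\<forall>i. x $ i \<le> R) \<Longrightarrow> y \<in> P \<Longrightarrow> \<exists>y'\<in>P.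
        (\<forall>i. x $ i \<le> - M2 \<longrightarrow> y' $ i = 0) \<and>
        x \<bullet> y + real (zero_count y) \<le> x \<bullet> y' + real (zero_count y')"
      using reduce_exponent[OF cpt orth zero R] by blast
    define m where "m = max M1 M2"
    define x where "x = clipped_log m z"
    have "log_indicator P z \<le> ereal (penalised_support P x)"
      unfolding x_def by (rule log_indicator_le_penalised_support[OF b ne orth])
    moreover have "0 \<le> log_indicator P z" by (rule log_indicator_nonneg[OF zero])
    ultimately obtain h where h: "log_indicator P z = ereal h" "h \<le> penalised_support P x"
      by (cases "log_indicator P z") auto
    have xR: "\<forall>i. x $ i \<le> R"
      using ln_cmod_le[OF _ zR] R M1(1) by (auto simp: x_def clipped_log_def m_def)
    have "penalised_support P x \<le> h + real CARD('d)"
      unfolding x_def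
    proof (rule penalised_support_le_log_indicator[OF b ne _ h(1)])
      fix y assume "y \<in> P"
      from M2(2)[OF xR this] obtain y' where y': "y' \<in> P" "\<forall>i. x $ i \<le> - M2 \<longrightarrow> y' $ i = 0"
        "x \<bullet> y + real (zero_count y) \<le> x \<bullet> y' + real (zero_count y')" by blast
      have "- m \<le> - M2" by (simp add: m_def)
      then have "\<forall>i. x $ i \<le> - m \<longrightarrow> y' $ i = 0" using y'(2) order_trans by blast
      then show "\<exists>y'\<in>P. (\<forall>i. clipped_log m z $ i \<le> - m \<longrightarrow> y' $ i = 0) \<and>
          clipped_log m z \<bullet> y + real (zero_count y) \<le> clipped_log m z \<bullet> y' + real (zero_count y')"
        using y'(1,3) unfolding x_def by blast
    qed
    moreover have "toric f z = f x" unfolding x_def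
    proof (rule toric_eq[of M1 R f z m])
      show "M1 \<le> m" unfolding m_def by (rule max.cobounded1)
    qed (fact M1 R zR)+
    moreover have "\<bar>f x - penalised_support P x\<bar> \<le> L"
      unfolding f_def by (rule mollify_near[OF L(2,1)])
    ultimately have "\<bar>toric f z - h\<bar> \<le> L + real CARD('d)" using h(2) by linarith
    then show ?thesis using h(1) by blast
  qed
  then show "\<exists>C. \<forall>z. \<exists>h. log_indicator P z = ereal h \<and> \<bar>toric f z - h\<bar> \<le> C" by blast
qed

text \<open>At \<open>z\<close> the tangent to \<open>log (exp s + exp t)\<close> combines the pluriharmonic minorant of the toric function
  and \<open>V\<close> with weights \<open>p, q > 0\<close> into a minorant of \<open>u\<close> of the form required by \<open>levi_pos\<close>.\<close>

lemma levi_ln_sum_exp_pos: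
  fixes f :: "real^'d \<Rightarrow> real"
  assumes f: "log_local f" and b: "0 < b" and w: "w \<noteq> 0"
  defines "V \<equiv> \<lambda>z. b * ln (1 + (norm z)\<^sup>2)"
  defines "u \<equiv> \<lambda>z. ln (exp (toric f z) + exp (V z))"
  shows "C2_on UNIV u" and "0 < levi u z w"
proof -
  have V: "C2_on UNIV V"
    unfolding V_def by (intro C2_on_mult C2_on_const C2_on_ln_norm open_UNIV)
  have exp: "C2_on UNIV (\<lambda>z. exp (g z))" if "C2_on UNIV g" for g :: "complex^'d \<Rightarrow> real"
    by (rule C2_on_compose_real[OF open_UNIV C2_on_exp that]) simp
  have "C2_on UNIV (\<lambda>z. exp (toric f z) + exp (V z))"
    by (intro C2_on_add open_UNIV exp V log_local.toric_C2[OF f])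
  then show u: "C2_on UNIV u"
    unfolding u_def by (rule C2_on_compose_real[OF open_UNIV C2_on_ln]) (auto intro: add_pos_pos)
  obtain a where a: "\<forall>\<^sub>F x in nhds z. toric f z
      + (\<Sum>i | z $ i \<noteq> 0. a i * (ln (cmod (x $ i)) - ln (cmod (z $ i)))) \<le> toric f x"
    using log_local.toric_pluriharmonic_minorant[OF f] by blast
  define s where "s = exp (toric f z) + exp (V z)"
  define p q where "p = exp (toric f z) / s" and "q = exp (V z) / s"
  have s: "0 < s" by (simp add: s_def add_pos_pos)
  have pq: "0 < p" "0 < q" using s by (simp_all add: p_def q_def)
  let ?S = "\<lambda>x. \<Sum>i | z $ i \<noteq> 0. a i * ln (cmod (x $ i))"
  define c where "c = u z - p * ?S z - q * V z"
  have sum: "(\<Sum>i | z $ i \<noteq> 0. p * a i * ln (cmod (x $ i))) = p * ?S x" for x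
    by (simp add: sum_distrib_left mult.assoc)
  show "0 < levi u z w"
  proof (rule levi_pos[OF u _ w])
    show "0 < q * b" using pq b by simp
    show "c + (\<Sum>i | z $ i \<noteq> 0. p * a i * ln (cmod (z $ i))) + q * b * ln (1 + (norm z)\<^sup>2) = u z"
      by (simp add: sum c_def V_def)
    show "\<forall>\<^sub>F x in nhds z. c + (\<Sum>i | z $ i \<noteq> 0. p * a i * ln (cmod (x $ i)))
        + q * b * ln (1 + (norm x)\<^sup>2) \<le> u x"
      using a
    proof eventually_elim
      case (elim x)
      have "(\<Sum>i | z $ i \<noteq> 0. a i * (ln (cmod (x $ i)) - ln (cmod (z $ i)))) = ?S x - ?S z"
        by (simp add: right_diff_distrib sum_subtractf)
      with elim have "?S x - ?S z \<le> toric f x - toric f z" by simp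
      then have "p * (?S x - ?S z) \<le> p * (toric f x - toric f z)"
        using pq by (intro mult_left_mono) auto
      moreover have "u z + p * (toric f x - toric f z) + q * (V x - V z) \<le> u x"
        unfolding u_def p_def q_def s_def by (rule ln_sum_exp_minorant)
      moreover have "c + p * ?S x + q * V x = u z + p * (?S x - ?S z) + q * (V x - V z)"
        by (simp add: c_def algebra_simps)
      ultimately show ?case unfolding sum by (simp add: V_def)
    qed
  qed
qed

theorem mainTheorem3:
  fixes P :: "(real^'d) set"
  assumes "convex_body P"
    and "\<exists>k::nat. 0 < k \<and> unit_simplex \<subseteq> (\<lambda>x. real k *\<^sub>R x) ` P"
  shows "\<exists>u :: complex^'d \<Rightarrow> real.
           (\<lambda>z. ereal (u z)) \<in> L_plus_class P \<and>
           strictly_psh_on UNIV u \<and>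
           (\<exists>C::real. \<forall>z. \<bar>ereal (u z) - log_indicator P z\<bar> \<le> ereal C)"
proof -
  have cpt: "compact P" and orth: "P \<subseteq> nonneg_orthant"
    using assms(1) by (auto simp: convex_body_def)
  obtain k :: nat where k: "0 < k" and sub: "unit_simplex \<subseteq> (\<lambda>x. real k *\<^sub>R x) ` P"
    using assms(2) by blast
  have scaled: "inverse (real k) *\<^sub>R x \<in> P" if x: "x \<in> unit_simplex" for x
  proof -
    obtain y where "y \<in> P" "x = real k *\<^sub>R y" using sub x by blast
    then show ?thesis using k by simp
  qed
  define r where "r = inverse (real k)"
  have r: "0 < r" using k by (simp add: r_def)
  have zero: "0 \<in> P" using scaled[of 0] by (simp add: unit_simplex_def)
  have ax: "axis i r \<in> P" for i
  proof -
    have "axis i 1 \<in> (unit_simplex :: (real^'d) set)"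
      by (auto simp: unit_simplex_def axis_def)
    moreover have "inverse (real k) *\<^sub>R axis i 1 = (axis i r :: real^'d)"
      by (simp add: r_def vec_eq_iff axis_def)
    ultimately show ?thesis using scaled by metis
  qed
  define f where "f = mollify (penalised_support P)"
  have loc: "log_local f" unfolding f_def by (rule toric_mollified_support[OF cpt orth zero])
  obtain C where C: "\<And>z. \<exists>h. log_indicator P z = ereal h \<and> \<bar>toric f z - h\<bar> \<le> C"
    using toric_mollified_support(2)[OF cpt orth zero] unfolding f_def by blast
  define u where "u z = ln (exp (toric f z) + exp (r / 2 * ln (1 + (norm z)\<^sup>2)))" for z
  note levi = levi_ln_sum_exp_pos[OF loc, of "r / 2", folded u_def[abs_def]]
  have u: "C2_on UNIV u" using levi(1)[of "axis undefined 1"] r by (simp add: axis_eq_0_iff)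
  have pos: "0 < levi u z w" if "w \<noteq> 0" for z w using levi(2)[OF _ that] r by simp
  define C' where "C' = max C (r / 2 * ln (1 + real CARD('d))) + ln 2"
  have bound: "\<exists>h. log_indicator P z = ereal h \<and> \<bar>u z - h\<bar> \<le> C'" for z
  proof -
    obtain h where h: "log_indicator P z = ereal h" "\<bar>toric f z - h\<bar> \<le> C" using C by blast
    let ?m = "max C (r / 2 * ln (1 + real CARD('d)))"
    have "exp (toric f z) \<le> exp (h + ?m)" "exp (r / 2 * ln (1 + (norm z)\<^sup>2)) \<le> exp (h + ?m)"
      using h(2) ln_norm_le_log_indicator[OF zero r ax h(1)] by auto
    then have "exp (toric f z) + exp (r / 2 * ln (1 + (norm z)\<^sup>2)) \<le> 2 * exp (h + ?m)" by linarith
    then have "u z \<le> ln (2 * exp (h + ?m))"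
      unfolding u_def by (subst ln_le_cancel_iff) (auto intro: add_pos_pos)
    also have "\<dots> = h + C'" by (simp add: ln_mult C'_def)
    finally have "u z \<le> h + C'" .
    moreover have "toric f z \<le> u z"
      unfolding u_def by (subst ln_ge_iff) (auto intro: add_pos_pos)
    moreover have "C \<le> C'" unfolding C'_def by (simp add: add_increasing2)
    ultimately have "\<bar>u z - h\<bar> \<le> C'" using h(2) by linarith
    then show ?thesis using h(1) by blast
  qed
  have lower: "log_indicator P z + ereal (- C') \<le> ereal (u z)"
    and upper: "ereal (u z) \<le> log_indicator P z + ereal C'"
    and diff: "\<bar>ereal (u z) - log_indicator P z\<bar> \<le> ereal C'" for z
    using bound[of z] by auto
  have "(\<lambda>z. ereal (u z)) \<in> PSH"
  proof (rule psh_in_PSH[OF u])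
    show "0 \<le> levi u z w" for z w
      using pos[of w z] levi_zero[OF u, of z] by (cases "w = 0") auto
  qed
  then have "(\<lambda>z. ereal (u z)) \<in> L_class P"
    unfolding L_class_def using upper by (auto intro!: exI[of _ C'])
  then have "(\<lambda>z. ereal (u z)) \<in> L_plus_class P"
    unfolding L_plus_class_def using lower by (auto intro!: exI[of _ "- C'"])
  moreover have "strictly_psh_on UNIV u"
    by (rule strictly_psh_on_UNIV_I[OF u pos])
  ultimately show ?thesis using diff by blast
qed

end
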